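(* Let $\bm{Z}(\bm{s})=(Z_1(\bm{s}),\ldots,Z_m(\bm{s}))^\top$, $\bm{s}\in\mathbb{S}^2$, be the multivariate skew-Gaussian random field $$Z_i(\bm{s})=\mu_i+\eta_i|X_i(\bm{s})|+\sigma_iY_i(\bm{s}),\qquad \bm{s}\in\mathbb{S}^2,\quad i=1,\ldots,m,$$ described in the context, with $\eta_i\neq 0$ for all $i=1,\ldots,m$. Consider two sites $\bm{s}_k,\bm{s}_l\in\mathbb{S}^2$ and let $\theta=\theta(\bm{s}_k,\bm{s}_l)$. The log likelihood associated to the pair $\bm{Z}_{ijkl}=(Z_i(\bm{s}_k),Z_j(\bm{s}_l))^\top$ is given by $$\ell_{ijkl}(\bm{\lambda})=\log\left(2\sum_{t=1}^{2}\phi_2(\bm{Z}_{ijkl}-\bm{\mu};A_t)\,\Phi_2(L_t;B_t)\right),$$ where $$\bm{\mu}=(\mu_i,\mu_j)^\top,$$ $$A_t=\Omega_2+\Upsilon^{-1}\,\Omega\big[(-1)^t r^x_{ij}(\theta)\big]\,\Upsilon^{-1},$$ $$B_t=\Big([\Upsilon\Omega_2\Upsilon]^{-1}+\Omega\big[(-1)^t r^x_{ij}(\theta)\big]^{-1}\Big)^{-1},$$ $$L_t=\Big[I_2+\Upsilon\Omega_2\Upsilon\,\Omega\big[(-1)^t r^x_{ij}(\theta)\big]^{-1}\Big]^{-1}\Upsilon(\bm{Z}_{ijkl}-\bm{\mu}),$$ with $\Upsilon=\mathrm{diag}\{1/\eta_i,1/\eta_j\}$, $I_2$ the identity matrix of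 order $2\times2$, and $$\Omega_2=\begin{pmatrix}\sigma_i^2&\sigma_i\sigma_j\\ \sigma_i\sigma_j&\sigma_j^2\end{pmatrix}\circ\Omega\big(r^y_{ij}(\theta)\big).$$ This is a closed form expression for the bivariate distributions of the field, in which the correlation function $r^x_{ij}$ alternates its sign in each element of the sum; evaluating it requires the numerical calculation of the bivariate Gaussian cumulative distribution function.
   Context: $\mathbb{S}^2=\{\bm{s}\in\mathbb{R}^3:\|\bm{s}\|=1\}$ is the unit sphere ($\|\cdot\|$ the Euclidean norm), and $\theta(\bm{s}_1,\bm{s}_2)=\arccos(\bm{s}_1^\top\bm{s}_2)\in[0,\pi]$ is the geodesic distance. The latent fields $\{\bm{X}(\bm{s})=(X_1(\bm{s}),\ldots,X_m(\bm{s}))^\top:\bm{s}\in\mathbb{S}^2\}$ and $\{\bm{Y}(\bm{s})=(Y_1(\bm{s}),\ldots,Y_m(\bm{s}))^\top:\bm{s}\in\mathbb{S}^2\}$, with $m\in\mathbb{N}$, are stationary multivariate Gaussian random fields on $\mathbb{S}^2$. They are independent of each other, and their components have zero mean and unit variance. Their covariances are spherically isotropic: there are matrix-valued mappings $r^x,r^y:[0,\pi]\to\mathbb{R}^{m\times m}$ such that $\mathrm{cov}\{X_i(\bm{s}),X_j(\bm{s}')\}=r^x_{ij}(\theta(\bm{s},\bm{s}'))$ and $\mathrm{cov}\{Y_i(\bm{s}),Y_j(\bm{s}')\}=r^y_{ij}(\theta(\bm{s},\bm{s}'))$ for all $\bm{s},\bm{s}'\in\mathbb{S}^2$ and $i,j=1,\ldots,m$.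 The coefficients satisfy $\mu_i,\eta_i\in\mathbb{R}$ and $\sigma_i\in\mathbb{R}_+$, and $\bm{\lambda}\in\mathbb{R}^p$ denotes the parameter vector of the model. Notation: $\Omega(r)=\Omega[r]=\begin{pmatrix}1&r\\ r&1\end{pmatrix}$, and $\Omega[r]^{-1}$ is its inverse matrix. The symbol $\circ$ denotes the Hadamard (entrywise) product. $\phi_2(\bm{y};\Sigma)$ denotes the bivariate Gaussian density function with zero mean and covariance matrix $\Sigma$, evaluated at $\bm{y}$, and $\Phi_2(\bm{l};\Sigma)$ denotes the corresponding Gaussian cumulative distribution function, evaluated at $\bm{l}$. *)

theory Defs
  imports "HOL-Probability.Probability"
begin

abbreviation unit_sphere :: "(real^3) set" where
  "unit_sphere \<equiv> sphere 0 1"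

definition geodesic_dist :: "real^3 \<Rightarrow> real^3 \<Rightarrow> real" where
  "geodesic_dist s s' = arccos (s \<bullet> s')"

definition cov :: "'w measure \<Rightarrow> ('w \<Rightarrow> real) \<Rightarrow> ('w \<Rightarrow> real) \<Rightarrow> real" where
  "cov M U V = (\<integral>\<omega>. (U \<omega> - (\<integral>x. U x \<partial>M)) * (V \<omega> - (\<integral>x. V x \<partial>M)) \<partial>M)"

text \<open>A finite family is jointly Gaussian if its law is that of \<open>b + A W\<close> with \<open>W\<close> a vector of
  independent standard normals. The matrix \<open>A\<close> may be singular, so degenerate Gaussian laws are
  included; taking \<open>A\<close> square is no restriction, since every covariance matrix has a square root.\<close>

definition jointly_gaussian :: "'w measure \<Rightarrow> 'i set \<Rightarrow> ('i \<Rightarrow> 'w \<Rightarrow> real) \<Rightarrow> bool" where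
  "jointly_gaussian M I V \<longleftrightarrow>
     (\<forall>p\<in>I. V p \<in> borel_measurable M) \<and>
     (\<exists>(b :: 'i \<Rightarrow> real) (A :: 'i \<Rightarrow> 'i \<Rightarrow> real).
        distr M (\<Pi>\<^sub>M p\<in>I. borel) (\<lambda>\<omega>. \<lambda>p\<in>I. V p \<omega>) =
        distr (\<Pi>\<^sub>M p\<in>I. density lborel std_normal_density) (\<Pi>\<^sub>M p\<in>I. borel)
          (\<lambda>w. \<lambda>p\<in>I. b p + (\<Sum>q\<in>I. A p q * w q)))"

definition gaussian_random_field ::
    "'w measure \<Rightarrow> (real^3) set \<Rightarrow> (real^3 \<Rightarrow> 'w \<Rightarrow> real^'m) \<Rightarrow> bool" where
  "gaussian_random_field M D X \<longleftrightarrow>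
     (\<forall>I. finite I \<and> I \<subseteq> D \<times> UNIV \<longrightarrow> jointly_gaussian M I (\<lambda>(s, i) \<omega>. X s \<omega> $ i))"

text \<open>Strict stationarity (invariance of the finite-dimensional laws under rotations) is not listed
  separately: for a centred Gaussian field it follows from the isotropy of the covariances.\<close>

definition isotropic_gaussian_field ::
    "'w measure \<Rightarrow> (real^3 \<Rightarrow> 'w \<Rightarrow> real^'m) \<Rightarrow> (real \<Rightarrow> real^'m^'m) \<Rightarrow> bool" where
  "isotropic_gaussian_field M X r \<longleftrightarrow>
     gaussian_random_field M unit_sphere X \<and>
     (\<forall>s\<in>unit_sphere. \<forall>i. (\<integral>\<omega>. X s \<omega> $ i \<partial>M) = 0 \<and>
        cov M (\<lambda>\<omega>. X s \<omega> $ i) (\<lambda>\<omega>. X s \<omega> $ i) = 1) \<and>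
     (\<forall>s\<in>unit_sphere. \<forall>s'\<in>unit_sphere. \<forall>i j.
        cov M (\<lambda>\<omega>. X s \<omega> $ i) (\<lambda>\<omega>. X s' \<omega> $ j) = r (geodesic_dist s s') $ i $ j)"

text \<open>Independence of the two fields as processes, i.e. of the product \<open>\<sigma>\<close>-algebras they generate.\<close>

definition independent_fields ::
    "'w measure \<Rightarrow> (real^3 \<Rightarrow> 'w \<Rightarrow> real^'m) \<Rightarrow> (real^3 \<Rightarrow> 'w \<Rightarrow> real^'m) \<Rightarrow> bool" where
  "independent_fields M X Y \<longleftrightarrow>
     prob_space.indep_var M
       (\<Pi>\<^sub>M s\<in>unit_sphere. borel) (\<lambda>\<omega>. \<lambda>s\<in>unit_sphere. X s \<omega>)
       (\<Pi>\<^sub>M s\<in>unit_sphere. borel) (\<lambda>\<omega>. \<lambda>s\<in>unit_sphere. Y s \<omega>)"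

definition skew_gaussian_field ::
    "real^'m \<Rightarrow> real^'m \<Rightarrow> real^'m \<Rightarrow> (real^3 \<Rightarrow> 'w \<Rightarrow> real^'m) \<Rightarrow> (real^3 \<Rightarrow> 'w \<Rightarrow> real^'m)
      \<Rightarrow> real^3 \<Rightarrow> 'w \<Rightarrow> real^'m" where
  "skew_gaussian_field \<mu> \<eta> \<sigma> X Y s \<omega> = (\<chi> i. \<mu> $ i + \<eta> $ i * \<bar>X s \<omega> $ i\<bar> + \<sigma> $ i * Y s \<omega> $ i)"

text \<open>A density is only determined almost everywhere; the likelihood at a given data point refers
  to its continuous version, which is unique whenever it exists.\<close>

definition continuous_pdf :: "'w measure \<Rightarrow> ('w \<Rightarrow> 'b::euclidean_space) \<Rightarrow> 'b \<Rightarrow> real" where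
  "continuous_pdf M V = (THE f. continuous_on UNIV f \<and> (\<forall>z. 0 \<le> f z) \<and>
     distributed M lborel V (\<lambda>z. ennreal (f z)))"

text \<open>Log likelihood, as a function of the parameter, of data \<open>z\<close> under the statistical model in
  which the observation at parameter \<open>l\<close> is the random vector \<open>V l\<close> on the space \<open>P l\<close>.\<close>

definition log_likelihood ::
    "('p \<Rightarrow> 'w measure) \<Rightarrow> ('p \<Rightarrow> 'w \<Rightarrow> 'b::euclidean_space) \<Rightarrow> 'b \<Rightarrow> 'p \<Rightarrow> real" where
  "log_likelihood P V z l = ln (continuous_pdf (P l) (V l) z)"

definition Omega :: "real \<Rightarrow> real^2^2" where
  "Omega r = vector [vector [1, r], vector [r, 1]]"

definition hadamard :: "real^'n^'m \<Rightarrow> real^'n^'m \<Rightarrow> real^'n^'m" where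
  "hadamard A B = (\<chi> a b. A $ a $ b * B $ a $ b)"

definition Omega2 :: "real \<Rightarrow> real \<Rightarrow> real \<Rightarrow> real^2^2" where
  "Omega2 \<sigma>\<^sub>1 \<sigma>\<^sub>2 r =
     hadamard (vector [vector [\<sigma>\<^sub>1\<^sup>2, \<sigma>\<^sub>1 * \<sigma>\<^sub>2], vector [\<sigma>\<^sub>1 * \<sigma>\<^sub>2, \<sigma>\<^sub>2\<^sup>2]]) (Omega r)"

definition phi2 :: "real^2 \<Rightarrow> real^2^2 \<Rightarrow> real" where
  "phi2 y S = exp (- (y \<bullet> (matrix_inv S *v y)) / 2) / (2 * pi * sqrt (det S))"

definition Phi2 :: "real^2 \<Rightarrow> real^2^2 \<Rightarrow> real" where
  "Phi2 l S = (LINT y:{y. \<forall>n. y $ n \<le> l $ n}|lborel. phi2 y S)"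

end

theory Submission
  imports Defs
begin

text \<open>Write \<open>X\<close> for the pair \<open>(X\<^sub>i(s\<^sub>k), X\<^sub>j(s\<^sub>l))\<close>, \<open>\<epsilon>\<close> for the pair
  \<open>(\<sigma>\<^sub>i Y\<^sub>i(s\<^sub>k), \<sigma>\<^sub>j Y\<^sub>j(s\<^sub>l))\<close>, \<open>D = diag(\<eta>\<^sub>i, \<eta>\<^sub>j) = \<Upsilon>\<inverse>\<close> and \<open>Q = \<Omega>\<^sub>2\<close>. The observed pair is
  \<open>\<mu> + D |X| + \<epsilon>\<close>, where \<open>X\<close> has density \<open>\<phi>\<^sub>2(\<cdot>; \<Omega>(r))\<close>, \<open>\<epsilon>\<close> has density \<open>\<phi>\<^sub>2(\<cdot>; Q)\<close>, and the two are
  independent. Conditioning on \<open>X\<close> gives the density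
  \<open>f(z) = \<integral> \<phi>\<^sub>2(x; \<Omega>(r)) \<phi>\<^sub>2(z - \<mu> - D|x|; Q) dx\<close>.

  The sign alternation comes from folding this integral onto the positive orthant. Changing both
  signs of \<open>x\<close> leaves \<open>\<phi>\<^sub>2(x; \<Omega>(r))\<close> unchanged, and changing one of them replaces \<open>r\<close> by \<open>-r\<close>; so the
  four orthants contribute twice a term for \<open>r\<close> and twice a term for \<open>-r\<close>
  (\<open>nn_integral_fold_Omega\<close>).

  Each term is, with \<open>z - \<mu>\<close> renamed to \<open>z\<close> and \<open>R = \<Omega>(\<plusminus>r)\<close>, the marginal density at \<open>z\<close> of the linear
  Gaussian model \<open>z = D x + \<epsilon>\<close>, \<open>x \<sim> N(0, R)\<close>, with \<open>x\<close> restricted to the positive orthant. Completing the square in \<open>x\<close> (\<open>phi2_product\<close>) factors the joint density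
  as the marginal \<open>\<phi>\<^sub>2(z; Q + D R D\<^sup>T)\<close> times the conditional density of \<open>x\<close> given \<open>z\<close>, which is Gaussian
  with covariance \<open>B = (R\<inverse> + D\<^sup>T Q\<inverse> D)\<inverse>\<close> and mean \<open>B D\<^sup>T Q\<inverse> z\<close>. The conditional probability of the
  positive orthant is, by central symmetry, \<open>\<Phi>\<^sub>2\<close> evaluated at that mean (\<open>ennreal_skew_term\<close>).
  With \<open>\<Upsilon> = D\<inverse>\<close> the covariance and the mean take the form of \<open>B\<^sub>t\<close> and \<open>L\<^sub>t\<close> (\<open>skew_term_scaled\<close>).

  That the pairs have densities at all is extracted from the definition of joint normality: their laws
  are images of independent standard normals under an affine map, whose linear part \<open>C\<close> satisfies
  \<open>C C\<^sup>T =\<close> covariance and is therefore invertible as soon as the covariance is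
  (\<open>jointly_gaussian_pair_distributed\<close>). Finally, \<open>f\<close> is continuous by dominated convergence, and two
  continuous densities of the same law agree everywhere, so \<open>f\<close> is the density that enters the
  likelihood (\<open>continuous_pdf_eq\<close>).\<close>

section \<open>Symmetric positive definite matrices\<close>

lemma matrix_inv_mult:
  fixes A :: "real^'n^'n"
  assumes "invertible A"
  shows "A ** matrix_inv A = mat 1" and "matrix_inv A ** A = mat 1"
proof -
  have "A ** matrix_inv A = mat 1 \<and> matrix_inv A ** A = mat 1"
    unfolding matrix_inv_def using assms unfolding invertible_def by (rule someI_ex)
  then show "A ** matrix_inv A = mat 1" and "matrix_inv A ** A = mat 1" by auto
qed

lemma matrix_inv_unique:
  fixes A B :: "real^'n^'n"
  assumes "A ** B = mat 1"
  shows "matrix_inv A = B"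
proof -
  have "invertible A" using assms invertible_right_inverse by blast
  then have "matrix_inv A ** (A ** B) = B"
    by (simp add: matrix_mul_assoc matrix_inv_mult)
  then show ?thesis using assms by simp
qed

lemma invertible_matrix_inv:
  fixes A :: "real^'n^'n"
  assumes "invertible A"
  shows "invertible (matrix_inv A)"
  using matrix_inv_mult[OF assms] unfolding invertible_def by blast

lemma matrix_inv_matrix_inv:
  fixes A :: "real^'n^'n"
  assumes "invertible A"
  shows "matrix_inv (matrix_inv A) = A"
  by (rule matrix_inv_unique) (rule matrix_inv_mult[OF assms])

lemma matrix_inv_matrix_mult:
  fixes A B :: "real^'n^'n"
  assumes "invertible A" "invertible B"
  shows "matrix_inv (A ** B) = matrix_inv B ** matrix_inv A"
proof (rule matrix_inv_unique)
  have "A ** B ** (matrix_inv B ** matrix_inv A) = A ** (B ** matrix_inv B) ** matrix_inv A"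
    by (simp only: matrix_mul_assoc)
  then show "A ** B ** (matrix_inv B ** matrix_inv A) = mat 1"
    by (simp add: matrix_inv_mult assms)
qed

lemma matrix_inv_transpose:
  fixes A :: "real^'n^'n"
  assumes "invertible A"
  shows "matrix_inv (transpose A) = transpose (matrix_inv A)"
  by (rule matrix_inv_unique)
    (simp add: matrix_transpose_mul[symmetric] matrix_inv_mult assms transpose_mat)

lemma det_matrix_inv:
  fixes A :: "real^'n^'n"
  assumes "invertible A"
  shows "det (matrix_inv A) = inverse (det A)"
proof -
  have "det (matrix_inv A) * det A = 1"
    by (simp add: det_mul[symmetric] matrix_inv_mult assms)
  then show ?thesis by (metis inverse_unique mult.commute)
qed

lemma matrix_mult_add_distrib_right:
  fixes A B C :: "real^'n^'n"
  shows "(A + B) ** C = A ** C + B ** C"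
  by (simp add: matrix_matrix_mult_def vec_eq_iff distrib_right sum.distrib)

lemma matrix_mult_diff_distrib_left:
  fixes A B C :: "real^'n^'n"
  shows "A ** (B - C) = A ** B - A ** C"
  by (simp add: matrix_matrix_mult_def vec_eq_iff right_diff_distrib sum_subtractf)

lemma inner_matrix_vector_transpose:
  fixes A :: "real^'n^'m"
  shows "(A *v x) \<bullet> y = x \<bullet> (transpose A *v y)"
  by (metis dot_lmul_matrix transpose_matrix_vector vector_transpose_matrix)

definition pos_def :: "real^'n^'n \<Rightarrow> bool" where
  "pos_def S \<longleftrightarrow> transpose S = S \<and> (\<forall>x. x \<noteq> 0 \<longrightarrow> 0 < x \<bullet> (S *v x))"

lemma pos_def_invertible:
  assumes "pos_def S"
  shows "invertible S"
  unfolding invertible_left_inverse matrix_left_invertible_ker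
  using assms unfolding pos_def_def by force

lemma pos_def_quadratic_nonneg:
  assumes "pos_def S"
  shows "0 \<le> x \<bullet> (S *v x)"
  using assms unfolding pos_def_def by (cases "x = 0") (auto simp: less_imp_le)

lemma pos_def_matrix_inv:
  assumes "pos_def S"
  shows "pos_def (matrix_inv S)"
  unfolding pos_def_def
proof (intro conjI allI impI)
  note inv = pos_def_invertible[OF assms]
  show sym: "transpose (matrix_inv S) = matrix_inv S"
    using matrix_inv_transpose[OF inv] assms by (simp add: pos_def_def)
  fix x :: "real^'a" assume "x \<noteq> 0"
  let ?y = "matrix_inv S *v x"
  have x: "S *v ?y = x"
    by (simp add: matrix_vector_mul_assoc matrix_inv_mult[OF inv])
  then have "?y \<noteq> 0" using \<open>x \<noteq> 0\<close> by auto
  then have "0 < ?y \<bullet> (S *v ?y)" using assms by (simp add: pos_def_def)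
  then show "0 < x \<bullet> ?y" using x by (simp add: inner_commute)
qed

lemma pos_def_add:
  assumes "pos_def S" "pos_def T"
  shows "pos_def (S + T)"
proof -
  have "transpose (S + T) = transpose S + transpose T"
    by (simp add: transpose_def vec_eq_iff)
  then show ?thesis
    using assms unfolding pos_def_def
    by (auto simp: matrix_vector_mult_add_rdistrib inner_add_right intro: add_pos_pos)
qed

lemma pos_def_congruence:
  fixes C S :: "real^'n^'n"
  assumes "invertible C" "pos_def S"
  shows "pos_def (C ** S ** transpose C)"
  unfolding pos_def_def
proof (intro conjI allI impI)
  show "transpose (C ** S ** transpose C) = C ** S ** transpose C"
    using assms(2) by (simp add: pos_def_def matrix_transpose_mul matrix_mul_assoc)
  fix x :: "real^'n" assume x: "x \<noteq> 0"
  let ?y = "transpose C *v x"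
  have "invertible (transpose C)" using assms(1) by (rule transpose_invertible)
  then have "?y \<noteq> 0"
    using x unfolding invertible_left_inverse matrix_left_invertible_ker by blast
  then have "0 < ?y \<bullet> (S *v ?y)" using assms(2) unfolding pos_def_def by blast
  also have "?y \<bullet> (S *v ?y) = x \<bullet> ((C ** S ** transpose C) *v x)"
    by (simp only: inner_matrix_vector_transpose transpose_transpose matrix_vector_mul_assoc
        matrix_mul_assoc)
  finally show "0 < x \<bullet> ((C ** S ** transpose C) *v x)" .
qed

lemma pos_def_mat1: "pos_def (mat 1 :: real^'n^'n)"
  by (simp add: pos_def_def)

lemma matrix_eqI_2:
  fixes A B :: "'a^2^2"
  assumes "A $ 1 $ 1 = B $ 1 $ 1" "A $ 1 $ 2 = B $ 1 $ 2" "A $ 2 $ 1 = B $ 2 $ 1" "A $ 2 $ 2 = B $ 2 $ 2"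
  shows "A = B"
  using assms by (simp add: vec_eq_iff forall_2)

text \<open>The Cholesky factorisation. It exhibits every nondegenerate centred normal law on the plane as
  a linear image of the standard one, which is how the normalisation of \<^const>\<open>phi2\<close> is obtained.\<close>

lemma pos_def_2_factor:
  fixes S :: "real^2^2"
  assumes "pos_def S"
  obtains C :: "real^2^2" where "invertible C" "S = C ** transpose C"
proof -
  define a b d where "a = S $ 1 $ 1" and "b = S $ 1 $ 2" and "d = S $ 2 $ 2"
  have "transpose S $ 2 $ 1 = b" by (simp add: transpose_def b_def)
  then have b: "S $ 2 $ 1 = b" using assms by (simp add: pos_def_def)
  have quad: "x \<bullet> (S *v x) = a * (x$1)\<^sup>2 + 2 * b * x$1 * x$2 + d * (x$2)\<^sup>2" for x :: "real^2"
    by (simp add: inner_vec_def matrix_vector_mult_def sum_2 b a_def[symmetric] b_def[symmetric]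
        d_def[symmetric] power2_eq_square algebra_simps)
  have pos: "0 < a * (x$1)\<^sup>2 + 2 * b * x$1 * x$2 + d * (x$2)\<^sup>2" if "x \<noteq> 0" for x :: "real^2"
    using assms that unfolding pos_def_def quad by blast
  have "(vector [1, 0] :: real^2) \<noteq> 0" by (simp add: vec_eq_iff forall_2)
  from pos[OF this] have a: "a > 0" by simp
  \<comment> \<open>At \<open>(b, -a)\<close> the quadratic form takes the value \<open>a\<close> times the determinant.\<close>
  have "(vector [b, - a] :: real^2) \<noteq> 0" using a by (simp add: vec_eq_iff forall_2)
  from pos[OF this] have "0 < a * (a * d - b\<^sup>2)" by (simp add: power2_eq_square algebra_simps)
  then have D: "a * d - b\<^sup>2 > 0" using a by (simp add: zero_less_mult_iff)
  then have e: "d - b\<^sup>2 / a > 0" using a by (simp add: field_simps)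
  define C :: "real^2^2" where
    "C = vector [vector [sqrt a, 0], vector [b / sqrt a, sqrt (d - b\<^sup>2 / a)]]"
  have "det C = sqrt a * sqrt (d - b\<^sup>2 / a)" by (simp add: det_2 C_def)
  then have "det C > 0" using a e by simp
  then have "invertible C" by (simp add: invertible_det_nz)
  moreover have "S = C ** transpose C"
    using a e
    by (intro matrix_eqI_2)
      (simp_all add: matrix_matrix_mult_def transpose_def sum_2 C_def a_def[symmetric]
        b_def[symmetric] d_def[symmetric] b power2_eq_square[symmetric] power_divide)
  ultimately show ?thesis by (rule that)
qed

lemma pos_def_2_det_pos:
  fixes S :: "real^2^2"
  assumes "pos_def S"
  shows "0 < det S"
proof -
  obtain C :: "real^2^2" where "invertible C" "S = C ** transpose C"
    using pos_def_2_factor[OF assms] .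
  then show ?thesis by (simp add: det_mul invertible_det_nz zero_less_mult_iff) argo
qed

section \<open>Completing the square\<close>

text \<open>The matrix algebra behind the model \<open>z = D x + \<epsilon>\<close> with independent \<open>x \<sim> N(0, R)\<close> and
  \<open>\<epsilon> \<sim> N(0, Q)\<close>: \<open>A\<close> is the covariance of \<open>z\<close> and \<open>P\<close> the inverse covariance of \<open>x\<close> given \<open>z\<close>. Both the
  inverse of \<open>A\<close> and its determinant are read off from the exchange relation
  \<open>A Q\<inverse> D = D R P\<close>, which follows by expanding the two sides.\<close>

lemma linear_gaussian_model:
  fixes R Q D :: "real^'n^'n"
  assumes R: "pos_def R" and Q: "pos_def Q" and D: "invertible D"
  defines "A \<equiv> Q + D ** R ** transpose D"
    and "P \<equiv> matrix_inv R + transpose D ** matrix_inv Q ** D"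
  shows posterior_precision_pos_def: "pos_def P"
    and marginal_covariance_pos_def: "pos_def A"
    and woodbury: "matrix_inv A =
      matrix_inv Q - matrix_inv Q ** D ** matrix_inv P ** transpose D ** matrix_inv Q"
    and det_marginal_posterior: "det A * det (matrix_inv P) = det Q * det R"
proof -
  note Ri = matrix_inv_mult[OF pos_def_invertible[OF R]]
  note Qi = matrix_inv_mult[OF pos_def_invertible[OF Q]]
  show P: "pos_def P"
    unfolding P_def
    using pos_def_add[OF pos_def_matrix_inv[OF R]
        pos_def_congruence[OF transpose_invertible[OF D] pos_def_matrix_inv[OF Q]]]
    by simp
  note Pi = matrix_inv_mult[OF pos_def_invertible[OF P]]
  show A: "pos_def A"
    unfolding A_def by (rule pos_def_add[OF Q pos_def_congruence[OF D R]])
  have "A ** (matrix_inv Q ** D)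
      = (Q ** matrix_inv Q) ** D + D ** R ** (transpose D ** matrix_inv Q ** D)"
    unfolding A_def by (simp add: matrix_mult_add_distrib_right matrix_mul_assoc)
  also have "\<dots> = D ** (R ** matrix_inv R) + D ** R ** (transpose D ** matrix_inv Q ** D)"
    by (simp add: Qi Ri)
  also have "\<dots> = D ** R ** P"
    unfolding P_def by (simp add: matrix_add_ldistrib matrix_mul_assoc)
  finally have exch: "A ** (matrix_inv Q ** D) = D ** R ** P" .
  have "A ** (matrix_inv Q - matrix_inv Q ** D ** matrix_inv P ** transpose D ** matrix_inv Q)
      = A ** matrix_inv Q - (A ** (matrix_inv Q ** D)) ** matrix_inv P ** transpose D ** matrix_inv Q"
    by (simp add: matrix_mul_assoc matrix_mult_diff_distrib_left)
  also have "\<dots> = A ** matrix_inv Q - D ** R ** (P ** matrix_inv P) ** transpose D ** matrix_inv Q"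
    unfolding exch by (simp only: matrix_mul_assoc)
  also have "\<dots> = mat 1"
    unfolding A_def Pi by (simp add: matrix_mult_add_distrib_right Qi)
  finally show "matrix_inv A =
      matrix_inv Q - matrix_inv Q ** D ** matrix_inv P ** transpose D ** matrix_inv Q"
    by (rule matrix_inv_unique)
  have nz: "det D \<noteq> 0" "det Q \<noteq> 0" "det P \<noteq> 0"
    using D pos_def_invertible[OF Q] pos_def_invertible[OF P] by (simp_all add: invertible_det_nz)
  have "det A * (det (matrix_inv Q) * det D) = det D * det R * det P"
    using arg_cong[OF exch, of det] by (simp add: det_mul)
  then show "det A * det (matrix_inv P) = det Q * det R"
    using nz
    by (simp add: det_matrix_inv pos_def_invertible[OF Q] pos_def_invertible[OF P] field_simps)
qed

text \<open>Completing the square in \<open>x\<close>. The left side is a quadratic polynomial in \<open>x\<close> with leading part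
  \<open>P\<close> and linear part \<open>-2 D\<^sup>T Q\<inverse> z = -2 P c\<close>, so its minimum is at \<open>c\<close>; the constant that remains is a
  quadratic form in \<open>z\<close>, identified by the Woodbury formula.\<close>

lemma quadratic_completion:
  fixes R Q D :: "real^'n^'n" and x z :: "real^'n"
  assumes R: "pos_def R" and Q: "pos_def Q" and D: "invertible D"
  defines "A \<equiv> Q + D ** R ** transpose D"
    and "P \<equiv> matrix_inv R + transpose D ** matrix_inv Q ** D"
    and "c \<equiv> matrix_inv (matrix_inv R + transpose D ** matrix_inv Q ** D)
               *v (transpose D *v (matrix_inv Q *v z))"
  shows "x \<bullet> (matrix_inv R *v x) + (z - D *v x) \<bullet> (matrix_inv Q *v (z - D *v x))
    = z \<bullet> (matrix_inv A *v z) + (c - x) \<bullet> (P *v (c - x))"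
proof -
  note P = posterior_precision_pos_def[OF R Q D, folded P_def]
  let ?Q = "matrix_inv Q" and ?R = "matrix_inv R"
  let ?u = "transpose D *v (?Q *v z)"
  have Qs: "v \<bullet> (?Q *v w) = w \<bullet> (?Q *v v)" for v w
    using pos_def_matrix_inv[OF Q] inner_matrix_vector_transpose[of ?Q v w]
    unfolding pos_def_def by (metis inner_commute)
  have Ps: "v \<bullet> (P *v w) = w \<bullet> (P *v v)" for v w
    using P inner_matrix_vector_transpose[of P v w]
    unfolding pos_def_def by (metis inner_commute)
  have Pc: "P *v c = ?u"
    unfolding c_def P_def[symmetric]
    by (simp only: matrix_vector_mul_assoc matrix_mul_assoc matrix_inv_mult[OF pos_def_invertible[OF P]])
       simp
  have xPx: "x \<bullet> (P *v x) = x \<bullet> (?R *v x) + (D *v x) \<bullet> (?Q *v (D *v x))"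
    unfolding P_def
    by (simp only: matrix_vector_mult_add_rdistrib inner_add_right inner_matrix_vector_transpose
        matrix_vector_mul_assoc matrix_mul_assoc)
  have cross: "(D *v x) \<bullet> (?Q *v z) = x \<bullet> ?u"
    by (rule inner_matrix_vector_transpose)
  have "matrix_inv A *v z = ?Q *v z - ?Q *v (D *v c)"
    unfolding A_def woodbury[OF R Q D] c_def
    by (simp only: matrix_vector_mult_diff_rdistrib matrix_vector_mul_assoc matrix_mul_assoc)
  then have zAz: "z \<bullet> (matrix_inv A *v z) = z \<bullet> (?Q *v z) - c \<bullet> ?u"
    by (simp only: inner_diff_right Qs[of z "D *v c"] inner_matrix_vector_transpose)
  show ?thesis
    unfolding zAz
    by (simp only: matrix_vector_mult_diff_distrib inner_diff_left inner_diff_right xPx Pc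
        Ps[of c x] Qs[of z "D *v x"] cross)
qed

text \<open>Bayes' formula for the linear Gaussian model: likelihood times prior equals marginal times
  posterior. The exponents agree by completing the square, the normalising constants by the
  determinant identity.\<close>

lemma phi2_product:
  fixes R Q D :: "real^2^2" and x z :: "real^2"
  assumes R: "pos_def R" and Q: "pos_def Q" and D: "invertible D"
  shows "phi2 x R * phi2 (z - D *v x) Q
    = phi2 z (Q + D ** R ** transpose D)
      * phi2 (matrix_inv (matrix_inv R + transpose D ** matrix_inv Q ** D)
               *v (transpose D *v (matrix_inv Q *v z)) - x)
          (matrix_inv (matrix_inv R + transpose D ** matrix_inv Q ** D))"
proof -
  define A where "A = Q + D ** R ** transpose D"
  define P where "P = matrix_inv R + transpose D ** matrix_inv Q ** D"
  define c where "c = matrix_inv P *v (transpose D *v (matrix_inv Q *v z))"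
  note P = posterior_precision_pos_def[OF R Q D, folded P_def]
  have quad: "x \<bullet> (matrix_inv R *v x) + (z - D *v x) \<bullet> (matrix_inv Q *v (z - D *v x))
    = z \<bullet> (matrix_inv A *v z) + (c - x) \<bullet> (P *v (c - x))"
    unfolding A_def c_def P_def by (rule quadratic_completion[OF R Q D])
  have det: "sqrt (det R) * sqrt (det Q) = sqrt (det A) * sqrt (det (matrix_inv P))"
    using det_marginal_posterior[OF R Q D, folded A_def P_def]
    by (simp add: real_sqrt_mult[symmetric] mult.commute)
  have "phi2 x R * phi2 (z - D *v x) Q
      = exp (- (x \<bullet> (matrix_inv R *v x) + (z - D *v x) \<bullet> (matrix_inv Q *v (z - D *v x))) / 2)
        / ((2 * pi)\<^sup>2 * (sqrt (det R) * sqrt (det Q)))"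
    by (simp add: phi2_def exp_add[symmetric] power2_eq_square add_divide_distrib diff_divide_distrib)
  also have "\<dots> = phi2 z A * phi2 (c - x) (matrix_inv P)"
    unfolding quad det
    by (simp add: phi2_def exp_add[symmetric] power2_eq_square add_divide_distrib
        matrix_inv_matrix_inv[OF pos_def_invertible[OF P]] diff_divide_distrib)
  finally show ?thesis unfolding A_def c_def P_def .
qed

section \<open>Lebesgue measure on the plane\<close>

lemma borel_measurable_vector_2 [measurable]:
  fixes f g :: "'a \<Rightarrow> real"
  assumes [measurable]: "f \<in> borel_measurable M" "g \<in> borel_measurable M"
  shows "(\<lambda>x. vector [f x, g x] :: real^2) \<in> borel_measurable M"
proof -
  have "(\<lambda>x. vector [f x, g x] :: real^2) = (\<lambda>x. f x *\<^sub>R axis 1 1 + g x *\<^sub>R axis 2 1)"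
    by (simp add: fun_eq_iff vec_eq_iff forall_2 axis_def)
  then show ?thesis by simp
qed

lemma borel_measurable_matrix_vector [measurable]:
  fixes T :: "real^'n^'m"
  shows "(\<lambda>x. T *v x) \<in> borel_measurable borel"
  by (intro borel_measurable_continuous_onI linear_continuous_on matrix_vector_mul_bounded_linear)

text \<open>Tonelli's theorem for the Cartesian power \<^typ>\<open>real^2\<close>, whose Lebesgue measure is the image of
  the product measure because the two agree on boxes.\<close>

lemma nn_integral_lborel_vec2:
  fixes h :: "real^2 \<Rightarrow> ennreal"
  assumes [measurable]: "h \<in> borel_measurable borel"
  shows "(\<integral>\<^sup>+x. h x \<partial>lborel) = (\<integral>\<^sup>+a. \<integral>\<^sup>+b. h (vector [a, b]) \<partial>lborel \<partial>lborel)"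
proof -
  let ?T = "\<lambda>p :: real \<times> real. vector [fst p, snd p] :: real^2"
  have [measurable]: "?T \<in> borel_measurable borel"
    by (intro borel_measurable_vector_2 borel_measurable_continuous_onI continuous_intros)
  have Basis: "(Basis :: (real^2) set) = {axis 1 1, axis 2 1}"
    by (auto simp: Basis_vec_def UNIV_2)
  have ne: "axis (1::2) (1::real) \<noteq> axis 2 1" by (simp add: axis_eq_axis)
  have "lborel = distr lborel borel ?T"
  proof (rule lborel_eqI)
    fix l u :: "real^2"
    assume le: "\<And>b. b \<in> Basis \<Longrightarrow> l \<bullet> b \<le> u \<bullet> b"
    from le[of "axis 1 1"] le[of "axis 2 1"] have le': "l $ 1 \<le> u $ 1" "l $ 2 \<le> u $ 2"
      by (simp_all add: Basis inner_axis)
    have "emeasure (distr lborel borel ?T) (box l u) = emeasure lborel (?T -` box l u)"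
      by (simp add: emeasure_distr)
    also have "?T -` box l u = {l $ 1 <..< u $ 1} \<times> {l $ 2 <..< u $ 2}"
      by (auto simp: mem_box_cart forall_2)
    also have "emeasure lborel \<dots>
        = emeasure lborel {l $ 1 <..< u $ 1} * emeasure lborel {l $ 2 <..< u $ 2}"
      by (subst lborel_prod[symmetric], subst lborel.emeasure_pair_measure_Times) auto
    also have "\<dots> = ennreal (\<Prod>b\<in>Basis. (u - l) \<bullet> b)"
      using le' ne by (simp add: Basis inner_axis ennreal_mult)
    finally show "emeasure (distr lborel borel ?T) (box l u) = (\<Prod>b\<in>Basis. (u - l) \<bullet> b)" .
  qed simp
  then have "(\<integral>\<^sup>+x. h x \<partial>lborel) = (\<integral>\<^sup>+x. h x \<partial>distr lborel borel ?T)"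
    by simp
  also have "\<dots> = (\<integral>\<^sup>+p. h (?T p) \<partial>(lborel \<Otimes>\<^sub>M lborel))"
    by (subst nn_integral_distr) (simp_all add: lborel_prod)
  also have "\<dots> = (\<integral>\<^sup>+a. \<integral>\<^sup>+b. h (vector [a, b]) \<partial>lborel \<partial>lborel)"
    by (subst lborel.nn_integral_fst[symmetric]) simp_all
  finally show ?thesis .
qed

text \<open>The linear change of variables for nonnegative Borel functions. It reduces to the volume of the
  image of a set: the preimage of a box under \<open>T\<close> is an image under \<open>T\<inverse>\<close>, and \<open>T\<close> maps it back to the
  box.\<close>

lemma nn_integral_lborel_linear:
  fixes T :: "real^('n::{finite,wellorder})^('n::_)" and h :: "real^('n::_) \<Rightarrow> ennreal"
  assumes T: "invertible T" and [measurable]: "h \<in> borel_measurable borel"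
  shows "(\<integral>\<^sup>+x. h x \<partial>lborel) = \<bar>det T\<bar> * (\<integral>\<^sup>+x. h (T *v x) \<partial>lborel)"
proof -
  have "lborel = density (distr lborel borel ((*v) T)) (\<lambda>_. ennreal \<bar>det T\<bar>)" (is "_ = ?D")
  proof (rule lborel_eqI)
    fix l u :: "real^('n::_)"
    assume le: "\<And>b. b \<in> Basis \<Longrightarrow> l \<bullet> b \<le> u \<bullet> b"
    define S where "S = (*v) T -` box l u"
    have [measurable]: "S \<in> sets borel"
      unfolding S_def using measurable_sets_borel[OF borel_measurable_matrix_vector[of T]] by simp
    have S: "S = (*v) (matrix_inv T) ` box l u"
    proof safe
      fix x assume "x \<in> S"
      moreover have "x = matrix_inv T *v (T *v x)"
        by (simp add: matrix_vector_mul_assoc matrix_inv_mult[OF T])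
      ultimately show "x \<in> (*v) (matrix_inv T) ` box l u" unfolding S_def by blast
    next
      fix y assume "y \<in> box l u"
      then show "matrix_inv T *v y \<in> S"
        unfolding S_def by (simp add: matrix_vector_mul_assoc matrix_inv_mult[OF T])
    qed
    have "S \<in> lmeasurable"
      unfolding S by (rule measurable_linear_image) simp_all
    have image: "(*v) T ` S = box l u"
      unfolding S image_image by (simp add: matrix_vector_mul_assoc matrix_inv_mult[OF T])
    have "emeasure ?D (box l u) = ennreal \<bar>det T\<bar> * emeasure lborel S"
      by (simp add: emeasure_density nn_integral_cmult emeasure_distr S_def)
    also have "emeasure lborel S = ennreal (measure lebesgue S)"
      using emeasure_eq_measure2[OF \<open>S \<in> lmeasurable\<close>] by (simp add: measure_completion)
    also have "ennreal \<bar>det T\<bar> * \<dots> = ennreal (measure lebesgue ((*v) T ` S))"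
      using \<open>S \<in> lmeasurable\<close>
      by (subst measure_linear_image) (simp_all add: ennreal_mult)
    also have "\<dots> = (\<Prod>b\<in>Basis. (u - l) \<bullet> b)"
      unfolding image using le by (simp add: measure_lborel_box_eq)
    finally show "emeasure ?D (box l u) = (\<Prod>b\<in>Basis. (u - l) \<bullet> b)" .
  qed simp
  then have "(\<integral>\<^sup>+x. h x \<partial>lborel) = (\<integral>\<^sup>+x. h x \<partial>?D)" by simp
  also have "\<dots> = \<bar>det T\<bar> * (\<integral>\<^sup>+x. h (T *v x) \<partial>lborel)"
    by (simp add: nn_integral_density nn_integral_distr nn_integral_cmult)
  finally show ?thesis .
qed

lemma nn_integral_lborel_add:
  fixes h :: "'a::euclidean_space \<Rightarrow> ennreal"
  assumes [measurable]: "h \<in> borel_measurable borel"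
  shows "(\<integral>\<^sup>+x. h (t + x) \<partial>lborel) = (\<integral>\<^sup>+x. h x \<partial>lborel)"
  by (subst lborel_distr_plus[symmetric, of t], subst nn_integral_distr) simp_all

lemma nn_integral_lborel_reflect:
  fixes h :: "'a::euclidean_space \<Rightarrow> ennreal"
  assumes [measurable]: "h \<in> borel_measurable borel"
  shows "(\<integral>\<^sup>+x. h (t - x) \<partial>lborel) = (\<integral>\<^sup>+x. h x \<partial>lborel)"
  by (subst lborel_affine[of "-1" t], simp, subst nn_integral_density)
    (simp_all add: nn_integral_distr nn_integral_density)

lemma nn_integral_fold:
  fixes h :: "real \<Rightarrow> ennreal"
  assumes [measurable]: "h \<in> borel_measurable borel"
  shows "(\<integral>\<^sup>+x. h x \<partial>lborel) = (\<integral>\<^sup>+x. indicator {0..} x * (h x + h (- x)) \<partial>lborel)"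
proof -
  have "(\<integral>\<^sup>+x. h x \<partial>lborel) = (\<integral>\<^sup>+x. indicator {0..} x * h x + indicator {..<0} x * h x \<partial>lborel)"
    by (intro nn_integral_cong) (auto simp: indicator_def)
  also have "\<dots> = (\<integral>\<^sup>+x. indicator {0..} x * h x \<partial>lborel) + (\<integral>\<^sup>+x. indicator {..<0} x * h x \<partial>lborel)"
    by (rule nn_integral_add) simp_all
  also have "(\<integral>\<^sup>+x. indicator {..<0} x * h x \<partial>lborel)
      = (\<integral>\<^sup>+x. indicator {..<0} (- x) * h (- x) \<partial>lborel)"
    using nn_integral_lborel_reflect[of "\<lambda>x. indicator {..<0} x * h x" 0] by simp
  \<comment> \<open>The reflected half-line lacks the origin, which is a null set.\<close>
  also have "\<dots> = (\<integral>\<^sup>+x. indicator {0..} x * h (- x) \<partial>lborel)"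
    using AE_lborel_singleton[of "0::real"]
    by (intro nn_integral_cong_AE) (auto simp: indicator_def)
  finally show ?thesis by (simp add: nn_integral_add[symmetric] distrib_left)
qed

text \<open>The one-dimensional folding, applied in each coordinate; the four summands are the four sign
  patterns.\<close>

lemma nn_integral_fold_2:
  fixes h :: "real^2 \<Rightarrow> ennreal"
  assumes [measurable]: "h \<in> borel_measurable borel"
  shows "(\<integral>\<^sup>+x. h x \<partial>lborel) = (\<integral>\<^sup>+x. indicator {x. \<forall>n. 0 \<le> x $ n} x *
    (h x + h (- x) + (h (vector [- (x $ 1), x $ 2]) + h (vector [x $ 1, - (x $ 2)]))) \<partial>lborel)"
    (is "_ = (\<integral>\<^sup>+x. ?g x \<partial>lborel)")
proof -
  have "{x :: real^2. \<forall>n. 0 \<le> x $ n} = {x. 0 \<le> x $ 1} \<inter> {x. 0 \<le> x $ 2}"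
    by (auto simp: forall_2)
  moreover have "{x :: real^2. 0 \<le> x $ k} \<in> sets borel" for k
    by (intro borel_closed closed_Collect_le continuous_intros)
  ultimately have [measurable]: "{x :: real^2. \<forall>n. 0 \<le> x $ n} \<in> sets borel" by simp
  have minus: "- (vector [a, b] :: real^2) = vector [- a, - b]" for a b
    by (simp add: vec_eq_iff forall_2)
  have "(\<integral>\<^sup>+x. h x \<partial>lborel) = (\<integral>\<^sup>+a. indicator {0..} a *
      ((\<integral>\<^sup>+b. h (vector [a, b]) \<partial>lborel) + (\<integral>\<^sup>+b. h (vector [- a, b]) \<partial>lborel)) \<partial>lborel)"
    by (subst nn_integral_lborel_vec2, simp, subst nn_integral_fold) simp_all
  also have "\<dots> = (\<integral>\<^sup>+a. indicator {0..} a * (\<integral>\<^sup>+b. h (vector [a, b]) + h (vector [- a, b]) \<partial>lborel) \<partial>lborel)"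
    by (simp add: nn_integral_add)
  also have "\<dots> = (\<integral>\<^sup>+a. indicator {0..} a * (\<integral>\<^sup>+b. indicator {0..} b *
     (h (vector [a, b]) + h (vector [- a, b]) + (h (vector [a, - b]) + h (vector [- a, - b]))) \<partial>lborel) \<partial>lborel)"
    by (subst nn_integral_fold) simp_all
  also have "\<dots> = (\<integral>\<^sup>+a. \<integral>\<^sup>+b. ?g (vector [a, b]) \<partial>lborel \<partial>lborel)"
    by (subst nn_integral_cmult[symmetric], simp)
      (auto intro!: nn_integral_cong simp: minus forall_2 add_ac indicator_def)
  also have "\<dots> = (\<integral>\<^sup>+x. ?g x \<partial>lborel)"
    by (rule nn_integral_lborel_vec2[symmetric]) measurable
  finally show ?thesis .
qed

section \<open>The bivariate normal density\<close>

lemma continuous_on_phi2: "continuous_on UNIV (\<lambda>y. phi2 y S)"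
proof -
  have "continuous_on UNIV (\<lambda>y. matrix_inv S *v y)"
    by (rule linear_continuous_on[OF matrix_vector_mul_bounded_linear])
  then show ?thesis
    unfolding phi2_def divide_inverse[of "exp _"] by (intro continuous_intros) auto
qed

lemma borel_measurable_phi2 [measurable]: "(\<lambda>y. phi2 y S) \<in> borel_measurable borel"
  by (rule borel_measurable_continuous_onI[OF continuous_on_phi2])

lemma phi2_minus: "phi2 (- y) S = phi2 y S"
proof -
  have "matrix_inv S *v - y = - (matrix_inv S *v y)"
    using matrix_vector_mult_diff_distrib[of "matrix_inv S" 0 y] by simp
  then show ?thesis by (simp add: phi2_def)
qed

lemma phi2_pos:
  assumes "pos_def S"
  shows "0 < phi2 y S"
  using pos_def_2_det_pos[OF assms] by (simp add: phi2_def)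

lemma phi2_le:
  assumes "pos_def S"
  shows "phi2 y S \<le> 1 / (2 * pi * sqrt (det S))"
  using pos_def_2_det_pos[OF assms] pos_def_quadratic_nonneg[OF pos_def_matrix_inv[OF assms], of y]
  by (simp add: phi2_def divide_right_mono)

lemma phi2_mat_1: "phi2 x (mat 1) = std_normal_density (x $ 1) * std_normal_density (x $ 2)"
proof -
  have "matrix_inv (mat 1 :: real^2^2) = mat 1"
    by (rule matrix_inv_unique) simp
  then show ?thesis
    by (simp add: phi2_def std_normal_density_def inner_vec_def sum_2 power2_eq_square
        exp_add[symmetric] add_divide_distrib diff_divide_distrib)
qed

text \<open>The Gaussian density transforms as a density should under a linear map: the quadratic form is
  invariant, and \<open>|det T|\<close> is absorbed by the determinant of \<open>T S T\<^sup>T\<close>.\<close>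

lemma phi2_linear:
  fixes T S :: "real^2^2"
  assumes T: "invertible T" and S: "pos_def S"
  shows "\<bar>det T\<bar> * phi2 (T *v y) (T ** S ** transpose T) = phi2 y S"
proof -
  have Ti: "invertible (transpose T)" by (rule transpose_invertible[OF T])
  note Si = pos_def_invertible[OF S]
  have det: "det T \<noteq> 0" using T by (simp add: invertible_det_nz)
  have "matrix_inv (T ** S ** transpose T) = transpose (matrix_inv T) ** matrix_inv S ** matrix_inv T"
    by (simp add: matrix_inv_matrix_mult invertible_mult T Ti Si matrix_inv_transpose matrix_mul_assoc)
  then have "matrix_inv (T ** S ** transpose T) *v (T *v y)
      = transpose (matrix_inv T) *v (matrix_inv S *v ((matrix_inv T ** T) *v y))"
    by (simp only: matrix_vector_mul_assoc matrix_mul_assoc)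
  also have "\<dots> = transpose (matrix_inv T) *v (matrix_inv S *v y)"
    by (simp only: matrix_inv_mult[OF T] matrix_vector_mul_lid)
  finally have "(T *v y) \<bullet> (matrix_inv (T ** S ** transpose T) *v (T *v y))
      = (matrix_inv T *v (T *v y)) \<bullet> (matrix_inv S *v y)"
    by (simp only: inner_matrix_vector_transpose[of "matrix_inv T"])
  also have "matrix_inv T *v (T *v y) = y"
    by (simp add: matrix_vector_mul_assoc matrix_inv_mult[OF T])
  finally have quad: "(T *v y) \<bullet> (matrix_inv (T ** S ** transpose T) *v (T *v y))
      = y \<bullet> (matrix_inv S *v y)" .
  have "sqrt (det (T ** S ** transpose T)) = \<bar>det T\<bar> * sqrt (det S)"
    by (simp add: det_mul det_transpose real_sqrt_mult)
  then show ?thesis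
    using det by (simp add: phi2_def quad)
qed

lemma distributed_phi2_linear:
  fixes T S :: "real^2^2"
  assumes X: "distributed M lborel X (\<lambda>x. ennreal (phi2 x S))"
    and T: "invertible T" and S: "pos_def S"
  shows "distributed M lborel (\<lambda>\<omega>. T *v X \<omega>) (\<lambda>x. ennreal (phi2 x (T ** S ** transpose T)))"
  unfolding distributed_def
proof (intro conjI)
  have X_meas[measurable]: "X \<in> borel_measurable M" using X by (simp add: distributed_def)
  show "(\<lambda>\<omega>. T *v X \<omega>) \<in> measurable M lborel" by simp
  show "distr M lborel (\<lambda>\<omega>. T *v X \<omega>) = density lborel (\<lambda>x. ennreal (phi2 x (T ** S ** transpose T)))"
  proof (rule measure_eqI)
    fix E :: "(real^2) set" assume "E \<in> sets (distr M lborel (\<lambda>\<omega>. T *v X \<omega>))"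
    then have [measurable]: "E \<in> sets borel" by simp
    have "emeasure (distr M lborel (\<lambda>\<omega>. T *v X \<omega>)) E = (\<integral>\<^sup>+\<omega>. indicator E (T *v X \<omega>) \<partial>M)"
      by (subst nn_integral_indicator[symmetric], simp, subst nn_integral_distr) simp_all
    also have "\<dots> = (\<integral>\<^sup>+x. ennreal (phi2 x S) * indicator E (T *v x) \<partial>lborel)"
      by (subst distributed_nn_integral[OF X]) simp_all
    also have "\<dots> = (\<integral>\<^sup>+x. \<bar>det T\<bar> * (ennreal (phi2 (T *v x) (T ** S ** transpose T)) * indicator E (T *v x)) \<partial>lborel)"
      by (simp add: phi2_linear[OF T S, symmetric] ennreal_mult' mult.assoc)
    also have "\<dots> = \<bar>det T\<bar> * (\<integral>\<^sup>+x. ennreal (phi2 (T *v x) (T ** S ** transpose T)) * indicator E (T *v x) \<partial>lborel)"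
      by (rule nn_integral_cmult) simp
    also have "\<dots> = (\<integral>\<^sup>+x. ennreal (phi2 x (T ** S ** transpose T)) * indicator E x \<partial>lborel)"
      by (rule nn_integral_lborel_linear[OF T, symmetric]) simp
    also have "\<dots> = emeasure (density lborel (\<lambda>x. ennreal (phi2 x (T ** S ** transpose T)))) E"
      by (simp add: emeasure_density)
    finally show "emeasure (distr M lborel (\<lambda>\<omega>. T *v X \<omega>)) E
      = emeasure (density lborel (\<lambda>x. ennreal (phi2 x (T ** S ** transpose T)))) E" .
  qed simp
qed simp

lemma nn_integral_phi2:
  assumes "pos_def S"
  shows "(\<integral>\<^sup>+x. phi2 x S \<partial>lborel) = 1"
proof -
  obtain C :: "real^2^2" where C: "invertible C" "S = C ** transpose C"
    using pos_def_2_factor[OF assms] .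
  interpret N: prob_space "density lborel (\<lambda>x. ennreal (std_normal_density x))"
    by (rule prob_space_normal_density) simp
  have one: "(\<integral>\<^sup>+x. std_normal_density x \<partial>lborel) = 1"
    using N.emeasure_space_1 by (simp add: emeasure_density)
  have "(\<integral>\<^sup>+x. phi2 x S \<partial>lborel) = (\<integral>\<^sup>+x. \<bar>det C\<bar> * ennreal (phi2 (C *v x) (C ** mat 1 ** transpose C)) \<partial>lborel)"
    by (subst nn_integral_lborel_linear[OF C(1)]) (simp_all add: C(2) nn_integral_cmult)
  also have "\<dots> = (\<integral>\<^sup>+x. phi2 x (mat 1) \<partial>lborel)"
    by (simp add: phi2_linear[OF C(1) pos_def_mat1, symmetric] ennreal_mult')
  also have "\<dots> = 1"
    by (subst nn_integral_lborel_vec2)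
      (simp_all add: phi2_mat_1 ennreal_mult' nn_integral_cmult nn_integral_multc one)
  finally show ?thesis .
qed

lemma integrable_phi2:
  assumes "pos_def S"
  shows "integrable lborel (\<lambda>x. phi2 x S)"
  by (rule integrableI_nonneg)
    (use nn_integral_phi2[OF assms] in \<open>simp_all add: less_imp_le[OF phi2_pos[OF assms]]\<close>)

section \<open>Densities of nondegenerate Gaussian pairs\<close>

abbreviation std_normal :: "real measure" where
  "std_normal \<equiv> density lborel (\<lambda>x. ennreal (std_normal_density x))"

abbreviation std_normal_2 :: "(real^2) measure" where
  "std_normal_2 \<equiv> density lborel (\<lambda>x. ennreal (phi2 x (mat 1)))"

lemma prob_space_std_normal: "prob_space std_normal"
  by (rule prob_space_normal_density) simp

lemma std_normal_moments:
  shows "integrable std_normal (\<lambda>x. x)" "integral\<^sup>L std_normal (\<lambda>x. x) = 0"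
    and "integrable std_normal (\<lambda>x. x * x)" "integral\<^sup>L std_normal (\<lambda>x. x * x) = 1"
    and "integrable std_normal (\<lambda>x. 1 :: real)" "integral\<^sup>L std_normal (\<lambda>x. 1 :: real) = 1"
proof -
  interpret prob_space std_normal by (rule prob_space_std_normal)
  show "integrable std_normal (\<lambda>x. x)"
    using integrable_std_normal_moment[of 1] by (simp add: integrable_density)
  show "integral\<^sup>L std_normal (\<lambda>x. x) = 0"
    using integral_std_normal_moment_odd[of 0] by (simp add: integral_density)
  show "integrable std_normal (\<lambda>x. x * x)"
    using integrable_std_normal_moment[of 2] by (simp add: integrable_density power2_eq_square)
  show "integral\<^sup>L std_normal (\<lambda>x. x * x) = 1"
    using integral_std_normal_moment_even[of 1] by (simp add: integral_density power2_eq_square)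
  show "integrable std_normal (\<lambda>x. 1 :: real)" by simp
  show "integral\<^sup>L std_normal (\<lambda>x. 1 :: real) = 1" using prob_space by simp
qed

text \<open>Joint normality is defined through products of standard normals over an arbitrary index set; for two
  indices this identifies that product with the standard normal law on \<^typ>\<open>real^2\<close>, on which linear
  maps act by matrices.\<close>

lemma distr_PiM_std_normal:
  assumes "p \<noteq> q"
  shows "distr (\<Pi>\<^sub>M k\<in>{p, q}. std_normal) borel (\<lambda>w. vector [w p, w q]) = std_normal_2"
proof (rule measure_eqI)
  interpret product_sigma_finite "\<lambda>_. std_normal"
    unfolding product_sigma_finite_def
    using prob_space_std_normal by (blast intro: prob_space_imp_sigma_finite)
  have [measurable]: "(\<lambda>w. vector [w p, w q] :: real^2) \<in> borel_measurable (\<Pi>\<^sub>M k\<in>{p, q}. std_normal)"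
  proof (rule borel_measurable_vector_2)
    show "(\<lambda>w. w p) \<in> borel_measurable (\<Pi>\<^sub>M k\<in>{p, q}. std_normal)"
      using measurable_component_singleton[of p "{p, q}" "\<lambda>_. std_normal"] by simp
    show "(\<lambda>w. w q) \<in> borel_measurable (\<Pi>\<^sub>M k\<in>{p, q}. std_normal)"
      using measurable_component_singleton[of q "{p, q}" "\<lambda>_. std_normal"] by simp
  qed
  fix E assume "E \<in> sets (distr (\<Pi>\<^sub>M k\<in>{p, q}. std_normal) borel (\<lambda>w. vector [w p, w q] :: real^2))"
  then have [measurable]: "E \<in> sets borel" by simp
  have "emeasure (distr (\<Pi>\<^sub>M k\<in>{p, q}. std_normal) borel (\<lambda>w. vector [w p, w q])) E
      = (\<integral>\<^sup>+w. indicator E (vector [w p, w q]) \<partial>(\<Pi>\<^sub>M k\<in>{p, q}. std_normal))"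
    by (subst nn_integral_indicator[symmetric], simp, subst nn_integral_distr) simp_all
  also have "\<dots> = (\<integral>\<^sup>+z. indicator E (vector [fst z, snd z]) \<partial>(std_normal \<Otimes>\<^sub>M std_normal))"
    using assms by (subst product_nn_integral_pair[of "\<lambda>a b. indicator E (vector [a, b])"]) simp_all
  also have "\<dots> = (\<integral>\<^sup>+a. \<integral>\<^sup>+b. indicator E (vector [a, b]) \<partial>std_normal \<partial>std_normal)"
    using sigma_finite_measure.nn_integral_fst[OF prob_space_imp_sigma_finite[OF prob_space_std_normal],
        of "\<lambda>z. indicator E (vector [fst z, snd z])" std_normal] by simp
  also have "\<dots> = (\<integral>\<^sup>+a. \<integral>\<^sup>+b. ennreal (phi2 (vector [a, b]) (mat 1)) * indicator E (vector [a, b]) \<partial>lborel \<partial>lborel)"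
    by (simp add: nn_integral_density phi2_mat_1 ennreal_mult' nn_integral_cmult[symmetric] mult.assoc)
  also have "\<dots> = emeasure std_normal_2 E"
    by (subst emeasure_density) (simp_all add: nn_integral_lborel_vec2)
  finally show "emeasure (distr (\<Pi>\<^sub>M k\<in>{p, q}. std_normal) borel (\<lambda>w. vector [w p, w q])) E
      = emeasure std_normal_2 E" .
qed simp

text \<open>Independence of the two coordinates, in the form needed to compute moments.\<close>

lemma std_normal_2_product:
  fixes f g :: "real \<Rightarrow> real"
  assumes f: "integrable std_normal f" and g: "integrable std_normal g"
  shows "integrable std_normal_2 (\<lambda>x. f (x $ 1) * g (x $ 2))"
    and "integral\<^sup>L std_normal_2 (\<lambda>x. f (x $ 1) * g (x $ 2))
      = integral\<^sup>L std_normal f * integral\<^sup>L std_normal g"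
proof -
  interpret product_sigma_finite "\<lambda>_::2. std_normal"
    unfolding product_sigma_finite_def
    using prob_space_std_normal by (blast intro: prob_space_imp_sigma_finite)
  let ?N = "\<Pi>\<^sub>M k\<in>{1, 2::2}. std_normal"
  let ?h = "\<lambda>k::2. if k = 1 then f else g"
  have [measurable]: "f \<in> borel_measurable borel" "g \<in> borel_measurable borel"
    using f g by (auto dest: borel_measurable_integrable)
  have [measurable]: "(\<lambda>w. vector [w 1, w 2] :: real^2) \<in> borel_measurable ?N"
  proof (rule borel_measurable_vector_2)
    show "(\<lambda>w. w 1) \<in> borel_measurable ?N"
      using measurable_component_singleton[of 1 "{1, 2::2}" "\<lambda>_. std_normal"] by simp
    show "(\<lambda>w. w 2) \<in> borel_measurable ?N"
      using measurable_component_singleton[of 2 "{1, 2::2}" "\<lambda>_. std_normal"] by simp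
  qed
  have G: "std_normal_2 = distr ?N borel (\<lambda>w. vector [w 1, w 2])"
    by (rule distr_PiM_std_normal[symmetric]) simp
  have int: "integrable std_normal (?h k)" for k using f g by simp
  have prod: "(\<Prod>k\<in>{1, 2}. ?h k (w k)) = f (w 1) * g (w 2)" for w :: "2 \<Rightarrow> real" by simp
  show "integrable std_normal_2 (\<lambda>x. f (x $ 1) * g (x $ 2))"
    using product_integrable_prod[of "{1, 2}" ?h, OF _ int]
    unfolding G prod by (subst integrable_distr_eq) simp_all
  show "integral\<^sup>L std_normal_2 (\<lambda>x. f (x $ 1) * g (x $ 2))
      = integral\<^sup>L std_normal f * integral\<^sup>L std_normal g"
    using product_integral_prod[of "{1, 2}" ?h, OF _ int]
    unfolding G prod by (subst integral_distr) simp_all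
qed

lemma std_normal_2_moments:
  fixes a b :: 2
  shows "integrable std_normal_2 (\<lambda>x. x $ a)" "integral\<^sup>L std_normal_2 (\<lambda>x. x $ a) = 0"
    and "integrable std_normal_2 (\<lambda>x. x $ a * x $ b)"
    and "integral\<^sup>L std_normal_2 (\<lambda>x. x $ a * x $ b) = (if a = b then 1 else 0)"
proof -
  note m = std_normal_moments
  note p = std_normal_2_product
  have one: "measure std_normal UNIV = 1"
    using prob_space.prob_space[OF prob_space_std_normal] by simp
  have a: "a = 1 \<or> a = 2" and b: "b = 1 \<or> b = 2" by (rule exhaust_2)+
  show "integrable std_normal_2 (\<lambda>x. x $ a)" "integral\<^sup>L std_normal_2 (\<lambda>x. x $ a) = 0"
    using a p[OF m(1) m(5)] p[OF m(5) m(1)] by (auto simp: m one)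
  show "integrable std_normal_2 (\<lambda>x. x $ a * x $ b)"
    and "integral\<^sup>L std_normal_2 (\<lambda>x. x $ a * x $ b) = (if a = b then 1 else 0)"
    using a b p[OF m(1) m(1)] p[OF m(3) m(5)] p[OF m(5) m(3)] by (auto simp: m one mult.commute)
qed

lemma prob_space_std_normal_2: "prob_space std_normal_2"
  by (rule prob_spaceI) (simp add: emeasure_density nn_integral_phi2[OF pos_def_mat1])

lemma jointly_gaussian_pair_law:
  assumes V: "jointly_gaussian M {p, q} V" and ne: "p \<noteq> q"
  obtains c :: "real^2" and C :: "real^2^2" where
    "distr M borel (\<lambda>\<omega>. vector [V p \<omega>, V q \<omega>]) = distr std_normal_2 borel (\<lambda>x. c + C *v x)"
proof -
  let ?I = "{p, q}"
  let ?k = "\<lambda>w. vector [w p, w q] :: real^2"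
  let ?N = "\<Pi>\<^sub>M k\<in>?I. std_normal"
  obtain b A where law: "distr M (\<Pi>\<^sub>M p\<in>?I. borel) (\<lambda>\<omega>. \<lambda>p\<in>?I. V p \<omega>) =
        distr ?N (\<Pi>\<^sub>M p\<in>?I. borel) (\<lambda>w. \<lambda>p\<in>?I. b p + (\<Sum>q\<in>?I. A p q * w q))"
    using V unfolding jointly_gaussian_def by auto
  have V_meas [measurable]: "V p \<in> borel_measurable M" "V q \<in> borel_measurable M"
    using V by (auto simp: jointly_gaussian_def)
  have comp: "(\<lambda>w. w k) \<in> borel_measurable ?N" if "k \<in> ?I" for k
    using measurable_component_singleton[OF that, of "\<lambda>_. std_normal"] by simp
  have [measurable]: "(\<lambda>w. w p) \<in> borel_measurable ?N" "(\<lambda>w. w q) \<in> borel_measurable ?N"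
    by (rule comp; simp)+
  have k [measurable]: "?k \<in> borel_measurable (\<Pi>\<^sub>M p\<in>?I. borel)"
    by (intro borel_measurable_vector_2 measurable_component_singleton) auto
  have restr: "(\<lambda>\<omega>. \<lambda>p\<in>?I. V p \<omega>) \<in> measurable M (\<Pi>\<^sub>M p\<in>?I. borel)"
    by (rule measurable_restrict) auto
  have affine: "(\<lambda>w. \<lambda>p\<in>?I. b p + (\<Sum>q\<in>?I. A p q * w q)) \<in> measurable ?N (\<Pi>\<^sub>M p\<in>?I. borel)"
    by (intro measurable_restrict borel_measurable_add borel_measurable_sum borel_measurable_times
        borel_measurable_const comp) auto
  define c :: "real^2" where "c = vector [b p, b q]"
  define C :: "real^2^2" where "C = vector [vector [A p p, A p q], vector [A q p, A q q]]"
  have "distr M borel (\<lambda>\<omega>. vector [V p \<omega>, V q \<omega>])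
      = distr (distr M (\<Pi>\<^sub>M p\<in>?I. borel) (\<lambda>\<omega>. \<lambda>p\<in>?I. V p \<omega>)) borel ?k"
    by (subst distr_distr[OF k restr]) (simp add: comp_def)
  also have "\<dots> = distr ?N borel (\<lambda>w. c + C *v ?k w)"
    unfolding law using ne
    by (subst distr_distr[OF k affine])
      (auto intro!: distr_cong simp: comp_def c_def C_def vec_eq_iff forall_2 matrix_vector_mult_def sum_2)
  also have "\<dots> = distr (distr ?N borel ?k) borel (\<lambda>x. c + C *v x)"
    by (subst distr_distr) (simp_all add: comp_def)
  also have "distr ?N borel ?k = std_normal_2"
    by (rule distr_PiM_std_normal[OF ne])
  finally show ?thesis by (rule that)
qed

text \<open>The affine representation of a Gaussian pair determines its moments: the mean is \<open>c\<close> and the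
  covariance is \<open>C C\<^sup>T\<close>. Hence \<open>c = 0\<close> for a centred pair, and an invertible covariance forces \<open>C\<close> to
  be invertible, so that the pair is a nondegenerate linear image of the standard normal law.\<close>

lemma jointly_gaussian_pair_distributed:
  fixes S :: "real^2^2"
  assumes V: "jointly_gaussian M {p, q} V" and ne: "p \<noteq> q"
    and mean: "integral\<^sup>L M (V p) = 0" "integral\<^sup>L M (V q) = 0"
    and S: "S = vector [vector [\<integral>\<omega>. V p \<omega> * V p \<omega> \<partial>M, \<integral>\<omega>. V p \<omega> * V q \<omega> \<partial>M],
                        vector [\<integral>\<omega>. V p \<omega> * V q \<omega> \<partial>M, \<integral>\<omega>. V q \<omega> * V q \<omega> \<partial>M]]"
    and inv: "invertible S"
  shows "pos_def S"
    and "distributed M lborel (\<lambda>\<omega>. vector [V p \<omega>, V q \<omega>]) (\<lambda>x. ennreal (phi2 x S))"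
proof -
  let ?W = "\<lambda>\<omega>. vector [V p \<omega>, V q \<omega>] :: real^2"
  have [measurable]: "V p \<in> borel_measurable M" "V q \<in> borel_measurable M"
    using V by (auto simp: jointly_gaussian_def)
  obtain c :: "real^2" and C :: "real^2^2" where
    law: "distr M borel ?W = distr std_normal_2 borel (\<lambda>x. c + C *v x)"
    using jointly_gaussian_pair_law[OF V ne] .
  interpret G: prob_space std_normal_2 by (rule prob_space_std_normal_2)
  note mom = std_normal_2_moments
  have transfer: "(\<integral>\<omega>. h (?W \<omega>) \<partial>M) = (\<integral>x. h (c + C *v x) \<partial>std_normal_2)"
    if [measurable]: "h \<in> borel_measurable borel" for h :: "real^2 \<Rightarrow> real"
    using arg_cong[OF law, of "\<lambda>m. integral\<^sup>L m h"] by (simp add: integral_distr)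
  have row: "(C *v x) $ a = C $ a $ 1 * x $ 1 + C $ a $ 2 * x $ 2" for a x
    by (simp add: matrix_vector_mult_def sum_2)
  have W: "(\<integral>\<omega>. ?W \<omega> $ a \<partial>M) = c $ a" for a
    using G.prob_space
    using transfer[of "\<lambda>x. x $ a"] by (simp add: row mom)
  have "c $ 1 = 0" "c $ 2 = 0" using W[of 1] W[of 2] mean by simp_all
  then have c: "c = 0" by (simp add: vec_eq_iff forall_2)
  have cov: "(\<integral>\<omega>. ?W \<omega> $ a * ?W \<omega> $ b \<partial>M) = C $ a $ 1 * C $ b $ 1 + C $ a $ 2 * C $ b $ 2" for a b
  proof -
    have "(\<integral>\<omega>. ?W \<omega> $ a * ?W \<omega> $ b \<partial>M) = (\<integral>x. C $ a $ 1 * C $ b $ 1 * (x $ 1 * x $ 1)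
        + (C $ a $ 1 * C $ b $ 2 + C $ a $ 2 * C $ b $ 1) * (x $ 1 * x $ 2)
        + C $ a $ 2 * C $ b $ 2 * (x $ 2 * x $ 2) \<partial>std_normal_2)"
      unfolding transfer[of "\<lambda>x. x $ a * x $ b", simplified]
      by (intro Bochner_Integration.integral_cong refl) (simp add: c row algebra_simps)
    then show ?thesis by (simp add: mom)
  qed
  have SC: "S = C ** transpose C"
    using cov[of 1 1] cov[of 1 2] cov[of 2 2] unfolding S
    by (intro matrix_eqI_2)
      (simp_all add: matrix_matrix_mult_def transpose_def sum_2 mult.commute)
  then have C: "invertible C"
    using inv by (simp add: invertible_det_nz det_mul)
  show "pos_def S"
    using pos_def_congruence[OF C pos_def_mat1] by (simp add: SC)
  have "distributed std_normal_2 lborel (\<lambda>x. x) (\<lambda>x. ennreal (phi2 x (mat 1)))"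
    unfolding distributed_def by (auto simp: distr_id2)
  from distributed_phi2_linear[OF this C pos_def_mat1]
  have "distr std_normal_2 lborel (\<lambda>x. C *v x) = density lborel (\<lambda>x. ennreal (phi2 x S))"
    by (simp add: distributed_def SC)
  moreover have "distr M lborel ?W = distr M borel ?W"
    and "distr std_normal_2 lborel (\<lambda>x. C *v x) = distr std_normal_2 borel (\<lambda>x. C *v x)"
    by (auto intro: distr_cong)
  ultimately have "distr M lborel ?W = density lborel (\<lambda>x. ennreal (phi2 x S))"
    using law by (simp add: c)
  then show "distributed M lborel ?W (\<lambda>x. ennreal (phi2 x S))"
    by (simp add: distributed_def)
qed

section \<open>Mixing over the orthant\<close>

abbreviation orthant :: "(real^2) set" where
  "orthant \<equiv> {x. \<forall>n. 0 \<le> x $ n}"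

abbreviation vabs :: "real^2 \<Rightarrow> real^2" where
  "vabs x \<equiv> \<chi> n. \<bar>x $ n\<bar>"

lemma closed_lower_orthant: "closed {y :: real^'n. \<forall>n. y $ n \<le> l $ n}"
  by (intro closed_Collect_all closed_Collect_le continuous_intros)

lemma closed_orthant: "closed orthant"
  by (intro closed_Collect_all closed_Collect_le continuous_intros)

lemma borel_lower_orthant [measurable]: "{y :: real^'n. \<forall>n. y $ n \<le> l $ n} \<in> sets borel"
  by (rule borel_closed[OF closed_lower_orthant])

lemma borel_orthant [measurable]: "orthant \<in> sets borel"
  by (rule borel_closed[OF closed_orthant])

lemma borel_measurable_vabs [measurable]: "vabs \<in> borel_measurable borel"
  by (intro borel_measurable_continuous_onI continuous_on_vec_lambda continuous_intros)

text \<open>The reflection \<open>y = l - x\<close> turns the lower orthant at \<open>l\<close> into the positive orthant.\<close>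

lemma ennreal_Phi2:
  assumes "pos_def S"
  shows "ennreal (Phi2 l S) = (\<integral>\<^sup>+x. indicator orthant x * ennreal (phi2 (l - x) S) \<partial>lborel)"
proof -
  let ?A = "{y :: real^2. \<forall>n. y $ n \<le> l $ n}"
  have "ennreal (Phi2 l S) = (\<integral>\<^sup>+y. ennreal (indicator ?A y *\<^sub>R phi2 y S) \<partial>lborel)"
    unfolding Phi2_def set_lebesgue_integral_def
    using integrable_mult_indicator[OF _ integrable_phi2[OF assms], of ?A]
    by (subst nn_integral_eq_integral) (auto simp: less_imp_le[OF phi2_pos[OF assms]])
  also have "\<dots> = (\<integral>\<^sup>+y. indicator ?A y * ennreal (phi2 y S) \<partial>lborel)"
    by (intro nn_integral_cong) (simp add: indicator_def)
  also have "\<dots> = (\<integral>\<^sup>+x. indicator ?A (l - x) * ennreal (phi2 (l - x) S) \<partial>lborel)"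
    by (rule nn_integral_lborel_reflect[symmetric]) simp
  also have "\<dots> = (\<integral>\<^sup>+x. indicator orthant x * ennreal (phi2 (l - x) S) \<partial>lborel)"
    by (intro nn_integral_cong) (simp add: indicator_def)
  finally show ?thesis .
qed

text \<open>A strictly positive density vanishes on no set of positive measure, and the orthant contains a
  nonempty open box.\<close>

lemma Phi2_pos:
  assumes "pos_def S"
  shows "0 < Phi2 l S"
proof -
  have "Phi2 l S \<noteq> 0"
  proof
    assume zero: "Phi2 l S = 0"
    have ne: "ennreal (phi2 y S) \<noteq> 0" for y
      using phi2_pos[OF assms, of y] by (simp add: ennreal_eq_0_iff not_le)
    have "(\<integral>\<^sup>+x. indicator orthant x * ennreal (phi2 (l - x) S) \<partial>lborel) = 0"
      using ennreal_Phi2[OF assms, of l] zero by simp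
    then have "AE x in lborel. indicator orthant x * ennreal (phi2 (l - x) S) = 0"
      by (subst (asm) nn_integral_0_iff_AE) simp_all
    then have ae: "AE x in lborel. x \<notin> orthant"
      by eventually_elim (use ne in \<open>auto simp: indicator_def split: if_splits\<close>)
    have "emeasure lborel orthant = 0"
      using ae by (subst (asm) AE_iff_measurable[of orthant]) auto
    moreover have "box 0 (vector [1, 1] :: real^2) \<subseteq> orthant"
      by (auto simp: mem_box_cart less_imp_le)
    ultimately have "emeasure lborel (box 0 (vector [1, 1] :: real^2)) = 0"
      by (metis emeasure_mono borel_orthant le_zero_eq sets_lborel)
    then have "box 0 (vector [1, 1] :: real^2) \<in> null_sets lborel" by (simp add: null_sets_def)
    then have "negligible (box 0 (vector [1, 1] :: real^2))"
      using negligible_iff_null_sets null_sets_completionI by blast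
    moreover have "(vector [1/2, 1/2] :: real^2) \<in> box 0 (vector [1, 1])"
      by (simp add: mem_box_cart forall_2)
    ultimately show False using open_not_negligible[OF open_box] by blast
  qed
  moreover have "0 \<le> Phi2 l S"
    unfolding Phi2_def set_lebesgue_integral_def
    by (intro integral_nonneg_AE) (simp add: less_imp_le[OF phi2_pos[OF assms]])
  ultimately show ?thesis by simp
qed

text \<open>The marginal density at \<open>z\<close> in the model \<open>z = D x + \<epsilon>\<close>, \<open>x \<sim> N(0, R)\<close>, \<open>\<epsilon> \<sim> N(0, Q)\<close>, times the
  conditional probability given \<open>z\<close> that both coordinates of \<open>x\<close> are nonnegative; the argument of
  \<^const>\<open>Phi2\<close> is the conditional mean.\<close>

definition skew_term :: "real^2^2 \<Rightarrow> real^2^2 \<Rightarrow> real^2^2 \<Rightarrow> real^2 \<Rightarrow> real" where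
  "skew_term R Q D z = phi2 z (Q + D ** R ** transpose D)
     * Phi2 (matrix_inv (matrix_inv R + transpose D ** matrix_inv Q ** D)
               *v (transpose D *v (matrix_inv Q *v z)))
         (matrix_inv (matrix_inv R + transpose D ** matrix_inv Q ** D))"

lemma skew_term_pos:
  assumes "pos_def R" "pos_def Q" "invertible D"
  shows "0 < skew_term R Q D z"
  unfolding skew_term_def
  by (intro mult_pos_pos phi2_pos Phi2_pos pos_def_matrix_inv marginal_covariance_pos_def
      posterior_precision_pos_def assms)

lemma ennreal_skew_term:
  assumes R: "pos_def R" and Q: "pos_def Q" and D: "invertible D"
  shows "ennreal (skew_term R Q D z)
    = (\<integral>\<^sup>+x. indicator orthant x * ennreal (phi2 x R * phi2 (z - D *v x) Q) \<partial>lborel)"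
proof -
  note A = marginal_covariance_pos_def[OF R Q D]
  note B = pos_def_matrix_inv[OF posterior_precision_pos_def[OF R Q D]]
  show ?thesis
    unfolding skew_term_def phi2_product[OF R Q D]
    by (subst ennreal_mult)
      (simp_all add: ennreal_Phi2[OF B] nn_integral_cmult[symmetric] ennreal_mult
        less_imp_le[OF phi2_pos[OF A]] less_imp_le[OF phi2_pos[OF B]] less_imp_le[OF Phi2_pos[OF B]]
        mult_ac)
qed

text \<open>Continuity is proved on the mixture integral and not on the closed form: there \<open>z\<close> enters only
  through the bounded continuous factor \<open>\<phi>\<^sub>2(z - D x; Q)\<close>, so that a multiple of \<open>\<phi>\<^sub>2(\<cdot>; R)\<close> dominates,
  whereas in \<open>\<Phi>\<^sub>2\<close> it moves the domain of integration.\<close>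

lemma continuous_on_skew_term:
  assumes R: "pos_def R" and Q: "pos_def Q" and D: "invertible D"
  shows "continuous_on UNIV (skew_term R Q D)"
proof -
  let ?g = "\<lambda>z x. indicator orthant x * (phi2 x R * phi2 (z - D *v x) Q)"
  let ?K = "1 / (2 * pi * sqrt (det Q))"
  have R0: "0 \<le> phi2 x R" for x using phi2_pos[OF R] less_imp_le by blast
  have Q0: "0 \<le> phi2 x Q" for x using phi2_pos[OF Q] less_imp_le by blast
  have bound: "norm (?g z x) \<le> phi2 x R * ?K" for z x
  proof -
    have "norm (?g z x) \<le> phi2 x R * phi2 (z - D *v x) Q"
      using R0[of x] Q0[of "z - D *v x"] by (simp add: indicator_def abs_mult)
    also have "\<dots> \<le> phi2 x R * ?K" by (intro mult_left_mono phi2_le Q R0)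
    finally show ?thesis .
  qed
  have K: "integrable lborel (\<lambda>x. phi2 x R * ?K)"
    by (rule integrable_mult_left) (rule integrable_phi2[OF R])
  have g_meas [measurable]: "?g z \<in> borel_measurable lborel" for z by simp
  have int: "integrable lborel (?g z)" for z
    by (rule Bochner_Integration.integrable_bound[OF K g_meas])
      (rule AE_I2, rule order_trans[OF bound], simp only: real_norm_def abs_ge_self)
  have eq: "skew_term R Q D z = (\<integral>x. ?g z x \<partial>lborel)" for z
  proof -
    have "ennreal (skew_term R Q D z) = (\<integral>\<^sup>+x. ennreal (?g z x) \<partial>lborel)"
      unfolding ennreal_skew_term[OF R Q D]
      by (intro nn_integral_cong) (simp add: indicator_def)
    also have "\<dots> = ennreal (\<integral>x. ?g z x \<partial>lborel)"
      by (rule nn_integral_eq_integral[OF int]) (simp add: R0 Q0)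
    finally show ?thesis
      by (subst (asm) ennreal_inj)
        (auto simp: R0 Q0 less_imp_le[OF skew_term_pos[OF assms]] intro!: integral_nonneg_AE)
  qed
  have "isCont (skew_term R Q D) z" for z
    unfolding isCont_def tendsto_at_iff_sequentially comp_def
  proof (intro allI impI)
    fix u :: "nat \<Rightarrow> real^2" assume u: "u \<longlonglongrightarrow> z"
    show "(\<lambda>n. skew_term R Q D (u n)) \<longlonglongrightarrow> skew_term R Q D z"
      unfolding eq
    proof (rule integral_dominated_convergence[OF _ _ K])
      show "AE x in lborel. (\<lambda>n. ?g (u n) x) \<longlonglongrightarrow> ?g z x"
      proof (rule AE_I2)
        fix x
        have "isCont (\<lambda>y. phi2 y Q) (z - D *v x)"
          using continuous_on_phi2 by (simp add: continuous_on_eq_continuous_at)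
        then have "(\<lambda>n. phi2 (u n - D *v x) Q) \<longlonglongrightarrow> phi2 (z - D *v x) Q"
          by (rule isCont_tendsto_compose) (intro tendsto_intros u)
        then show "(\<lambda>n. ?g (u n) x) \<longlonglongrightarrow> ?g z x" by (intro tendsto_intros)
      qed
    qed (use bound in auto)
  qed
  then show ?thesis by (simp add: continuous_on_eq_continuous_at)
qed

section \<open>Correlation matrices\<close>

lemma pos_def_Omega: "pos_def (Omega r) \<longleftrightarrow> r\<^sup>2 < 1"
proof
  assume "pos_def (Omega r)"
  from pos_def_2_det_pos[OF this] show "r\<^sup>2 < 1"
    by (simp add: det_2 Omega_def power2_eq_square)
next
  assume r: "r\<^sup>2 < 1"
  show "pos_def (Omega r)"
    unfolding pos_def_def
  proof (intro conjI allI impI)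
    show "transpose (Omega r) = Omega r"
      by (intro matrix_eqI_2) (simp_all add: transpose_def Omega_def)
    fix x :: "real^2" assume x: "x \<noteq> 0"
    have "x \<bullet> (Omega r *v x) = (x $ 1 + r * x $ 2)\<^sup>2 + (1 - r\<^sup>2) * (x $ 2)\<^sup>2"
      by (simp add: inner_vec_def matrix_vector_mult_def sum_2 Omega_def power2_eq_square algebra_simps)
    moreover have "0 < (x $ 1 + r * x $ 2)\<^sup>2 + (1 - r\<^sup>2) * (x $ 2)\<^sup>2"
    proof (cases "x $ 2 = 0")
      case True
      then have "x $ 1 \<noteq> 0" using x by (simp add: vec_eq_iff forall_2)
      then show ?thesis using True by simp
    next
      case False
      then show ?thesis using r by (intro add_nonneg_pos) simp_all
    qed
    ultimately show "0 < x \<bullet> (Omega r *v x)" by simp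
  qed
qed

text \<open>Changing the sign of one component changes the sign of the correlation. This is the source of the
  alternating sign in the likelihood.\<close>

lemma phi2_Omega_reflect:
  assumes "pos_def (Omega r)"
  shows "phi2 (vector [- (x $ 1), x $ 2]) (Omega r) = phi2 x (Omega (- r))"
    and "phi2 (vector [x $ 1, - (x $ 2)]) (Omega r) = phi2 x (Omega (- r))"
proof -
  let ?T = "vector [vector [- 1, 0], vector [0, 1]] :: real^2^2"
  have neg: "pos_def (Omega (- r))" using assms by (simp add: pos_def_Omega)
  have det: "det ?T = - 1" by (simp add: det_2)
  have "?T ** Omega (- r) ** transpose ?T = Omega r"
    by (intro matrix_eqI_2) (simp_all add: matrix_matrix_mult_def transpose_def sum_2 Omega_def)
  moreover have "?T *v x = vector [- (x $ 1), x $ 2]"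
    by (simp add: vec_eq_iff forall_2 matrix_vector_mult_def sum_2)
  ultimately show eq: "phi2 (vector [- (x $ 1), x $ 2]) (Omega r) = phi2 x (Omega (- r))"
    using phi2_linear[of ?T "Omega (- r)" x] neg det by (simp add: invertible_det_nz)
  have "vector [x $ 1, - (x $ 2)] = - (vector [- (x $ 1), x $ 2] :: real^2)"
    by (simp add: vec_eq_iff forall_2)
  then show "phi2 (vector [x $ 1, - (x $ 2)]) (Omega r) = phi2 x (Omega (- r))"
    by (simp add: phi2_minus eq)
qed

text \<open>A function of \<open>(|x\<^sub>1|, |x\<^sub>2|)\<close> is the same on all four orthants, so folding acts on the density
  alone: the sign patterns with equal signs give correlation \<open>r\<close>, the other two give \<open>-r\<close>.\<close>

lemma nn_integral_fold_Omega:
  fixes g :: "real^2 \<Rightarrow> ennreal"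
  assumes r: "pos_def (Omega r)" and [measurable]: "g \<in> borel_measurable borel"
  shows "(\<integral>\<^sup>+x. ennreal (phi2 x (Omega r)) * g (vabs x) \<partial>lborel)
    = 2 * ((\<integral>\<^sup>+x. indicator orthant x * (ennreal (phi2 x (Omega (- r))) * g x) \<partial>lborel)
         + (\<integral>\<^sup>+x. indicator orthant x * (ennreal (phi2 x (Omega r)) * g x) \<partial>lborel))"
proof -
  have abs: "vabs (- x) = x" "vabs (vector [- (x $ 1), x $ 2]) = x"
    "vabs (vector [x $ 1, - (x $ 2)]) = x" "vabs x = x"
    if "x \<in> orthant" for x
    using that by (auto simp: vec_eq_iff forall_2)
  have "(\<integral>\<^sup>+x. ennreal (phi2 x (Omega r)) * g (vabs x) \<partial>lborel)
    = (\<integral>\<^sup>+x. indicator orthant x * (2 * (ennreal (phi2 x (Omega (- r))) * g x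
        + ennreal (phi2 x (Omega r)) * g x)) \<partial>lborel)"
  proof (subst nn_integral_fold_2, simp, rule nn_integral_cong)
    fix x :: "real^2"
    show "indicator orthant x *
      (ennreal (phi2 x (Omega r)) * g (vabs x) + ennreal (phi2 (- x) (Omega r)) * g (vabs (- x)) +
       (ennreal (phi2 (vector [- (x $ 1), x $ 2]) (Omega r)) * g (vabs (vector [- (x $ 1), x $ 2])) +
        ennreal (phi2 (vector [x $ 1, - (x $ 2)]) (Omega r)) * g (vabs (vector [x $ 1, - (x $ 2)])))) =
      indicator orthant x * (2 * (ennreal (phi2 x (Omega (- r))) * g x + ennreal (phi2 x (Omega r)) * g x))"
    proof (cases "x \<in> orthant")
      case True
      show ?thesis
        unfolding abs[OF True] phi2_minus phi2_Omega_reflect[OF r]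
        by (simp add: mult_2 add_ac distrib_left)
    qed simp
  qed
  also have "\<dots> = (\<integral>\<^sup>+x. 2 * (indicator orthant x * (ennreal (phi2 x (Omega (- r))) * g x)
        + indicator orthant x * (ennreal (phi2 x (Omega r)) * g x)) \<partial>lborel)"
    by (intro nn_integral_cong) (simp add: indicator_def)
  finally show ?thesis by (simp add: nn_integral_cmult nn_integral_add)
qed

text \<open>Given \<open>X = x\<close>, the vector is \<open>Y\<close> translated by \<open>m + D |x|\<close>. Averaging the translated density over
  the law of \<open>X\<close> and folding leaves one mixture over the positive orthant for each sign of the
  correlation.\<close>

lemma (in prob_space) distributed_skew_gaussian_pair:
  fixes X Y :: "'a \<Rightarrow> real^2"
  assumes X: "distributed M lborel X (\<lambda>x. ennreal (phi2 x (Omega r)))"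
    and Y: "distributed M lborel Y (\<lambda>y. ennreal (phi2 y Q))"
    and indep: "indep_var lborel X lborel Y"
    and r: "pos_def (Omega r)" and Q: "pos_def Q" and D: "invertible D"
  shows "distributed M lborel (\<lambda>\<omega>. m + D *v vabs (X \<omega>) + Y \<omega>)
    (\<lambda>z. ennreal (2 * (skew_term (Omega (- r)) Q D (z - m) + skew_term (Omega r) Q D (z - m))))"
    (is "distributed M lborel ?Z (\<lambda>z. ennreal (?f z))")
  unfolding distributed_def
proof (intro conjI)
  note R0 = less_imp_le[OF phi2_pos[OF r]]
  have r': "pos_def (Omega (- r))" using r by (simp add: pos_def_Omega)
  note R0' = less_imp_le[OF phi2_pos[OF r']]
  have [measurable]: "X \<in> borel_measurable M" "Y \<in> borel_measurable M"
    using X Y by (simp_all add: distributed_def)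
  have [measurable]: "skew_term (Omega r) Q D \<in> borel_measurable borel"
      "skew_term (Omega (- r)) Q D \<in> borel_measurable borel"
    by (intro borel_measurable_continuous_onI continuous_on_skew_term r r' Q D)+
  have [measurable]: "(\<lambda>z. D *v vabs z) \<in> borel_measurable borel"
    by (rule measurable_compose[OF borel_measurable_vabs borel_measurable_matrix_vector])
  note XY = distributed_joint_indep[OF lborel.sigma_finite_measure_axioms
      lborel.sigma_finite_measure_axioms X Y indep]
  show "?Z \<in> measurable M lborel"
  proof -
    have "(\<lambda>\<omega>. D *v vabs (X \<omega>)) \<in> borel_measurable M"
      by (rule measurable_compose[of X M borel]) simp_all
    then show ?thesis by simp
  qed
  then have Z [measurable]: "?Z \<in> borel_measurable M" by simp
  show "(\<lambda>z. ennreal (?f z)) \<in> borel_measurable lborel" by simp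
  show "distr M lborel ?Z = density lborel (\<lambda>z. ennreal (?f z))"
  proof (rule measure_eqI)
    fix E :: "(real^2) set" assume "E \<in> sets (distr M lborel ?Z)"
    then have [measurable]: "E \<in> sets borel" by simp
    let ?p = "\<lambda>x. ennreal (phi2 x (Omega r))" and ?q = "\<lambda>y. ennreal (phi2 y Q)"
    let ?I = "indicator E :: real^2 \<Rightarrow> ennreal"
    let ?s = "\<lambda>x. m + D *v vabs x"
    have "emeasure (distr M lborel ?Z) E = (\<integral>\<^sup>+\<omega>. ?I (?s (X \<omega>) + Y \<omega>) \<partial>M)"
      by (subst nn_integral_indicator[symmetric], simp, subst nn_integral_distr) simp_all
    also have "\<dots> = (\<integral>\<^sup>+w. (case w of (x, y) \<Rightarrow> ?p x * ?q y) * ?I (?s (fst w) + snd w) \<partial>(lborel \<Otimes>\<^sub>M lborel))"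
      by (subst distributed_nn_integral[OF XY]) simp_all
    also have "\<dots> = (\<integral>\<^sup>+x. \<integral>\<^sup>+y. ?p x * ?q y * ?I (?s x + y) \<partial>lborel \<partial>lborel)"
      by (subst lborel.nn_integral_fst[symmetric]) simp_all
    also have "\<dots> = (\<integral>\<^sup>+x. \<integral>\<^sup>+z. ?p x * ?q (z - ?s x) * ?I z \<partial>lborel \<partial>lborel)"
    proof (rule nn_integral_cong)
      fix x
      show "(\<integral>\<^sup>+y. ?p x * ?q y * ?I (?s x + y) \<partial>lborel) = (\<integral>\<^sup>+z. ?p x * ?q (z - ?s x) * ?I z \<partial>lborel)"
        using nn_integral_lborel_add[of "\<lambda>z. ?p x * ?q (z - ?s x) * ?I z" "?s x"] by simp
    qed
    also have "\<dots> = (\<integral>\<^sup>+z. \<integral>\<^sup>+x. ?p x * ?q (z - ?s x) * ?I z \<partial>lborel \<partial>lborel)"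
      by (rule lborel_pair.Fubini'[symmetric]) simp
    also have "\<dots> = (\<integral>\<^sup>+z. ennreal (?f z) * ?I z \<partial>lborel)"
    proof (rule nn_integral_cong)
      fix z
      have "(\<integral>\<^sup>+x. ?p x * ?q (z - ?s x) * ?I z \<partial>lborel)
          = (\<integral>\<^sup>+x. ?p x * ?q ((z - m) - D *v vabs x) \<partial>lborel) * ?I z"
        by (subst nn_integral_multc) (simp_all add: diff_diff_eq)
      also have "(\<integral>\<^sup>+x. ?p x * ?q ((z - m) - D *v vabs x) \<partial>lborel)
          = 2 * (ennreal (skew_term (Omega (- r)) Q D (z - m)) + ennreal (skew_term (Omega r) Q D (z - m)))"
        by (subst nn_integral_fold_Omega[OF r, of "\<lambda>x. ?q ((z - m) - D *v x)"])
          (simp_all add: ennreal_mult'[OF R0] ennreal_mult'[OF R0']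
            ennreal_skew_term[OF r Q D] ennreal_skew_term[OF r' Q D])
      also have "\<dots> = ennreal (?f z)"
        using skew_term_pos[OF r Q D, of "z - m"] skew_term_pos[OF r' Q D, of "z - m"]
        by (subst ennreal_mult) simp_all
      finally show "(\<integral>\<^sup>+x. ?p x * ?q (z - ?s x) * ?I z \<partial>lborel) = ennreal (?f z) * ?I z" .
    qed
    also have "\<dots> = emeasure (density lborel (\<lambda>z. ennreal (?f z))) E"
      by (simp add: emeasure_density)
    finally show "emeasure (distr M lborel ?Z) E = emeasure (density lborel (\<lambda>z. ennreal (?f z))) E" .
  qed simp
qed

section \<open>The continuous density\<close>

text \<open>The set where two continuous functions differ is open, and a nonempty open set is not null.\<close>

lemma continuous_AE_lborel_eq:
  fixes f g :: "'a::euclidean_space \<Rightarrow> real"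
  assumes "continuous_on UNIV f" "continuous_on UNIV g" "AE x in lborel. f x = g x"
  shows "f = g"
proof (rule ccontr)
  assume "f \<noteq> g"
  then have ne: "{x. f x \<noteq> g x} \<noteq> {}" by auto
  have "open {x. f x \<noteq> g x}" by (rule open_Collect_neq[OF assms(1,2)])
  moreover have "{x. f x \<noteq> g x} \<in> null_sets lborel"
    using assms(3) \<open>open _\<close> AE_iff_null[of lborel "\<lambda>x. f x = g x"] by simp
  then have "negligible {x. f x \<noteq> g x}"
    using negligible_iff_null_sets null_sets_completionI by blast
  ultimately show False using ne open_not_negligible by blast
qed

lemma (in prob_space) continuous_pdf_eq:
  assumes f: "continuous_on UNIV f" "\<And>z. 0 \<le> f z" "distributed M lborel V (\<lambda>z. ennreal (f z))"
  shows "continuous_pdf M V = f"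
  unfolding continuous_pdf_def
proof (rule the_equality)
  show "continuous_on UNIV f \<and> (\<forall>z. 0 \<le> f z) \<and> distributed M lborel V (\<lambda>z. ennreal (f z))"
    using f by blast
  fix g assume g: "continuous_on UNIV g \<and> (\<forall>z. 0 \<le> g z) \<and> distributed M lborel V (\<lambda>z. ennreal (g z))"
  then have "AE z in lborel. ennreal (g z) = ennreal (f z)"
    using distributed_unique f(3) by blast
  then have "AE z in lborel. g z = f z"
    by eventually_elim (use f(2) g in \<open>simp add: ennreal_inj\<close>)
  then show "g = f" using f(1) g by (intro continuous_AE_lborel_eq) auto
qed

section \<open>The skew-Gaussian field\<close>

text \<open>The closed form in terms of \<open>U = D\<inverse>\<close>. With \<open>G = U Q U\<close> one has \<open>G\<inverse> = D Q\<inverse> D\<close>, hence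
  \<open>P = G\<inverse> + R\<inverse>\<close> and \<open>1 + G R\<inverse> = G P\<close>, so that \<open>(1 + G R\<inverse>)\<inverse> U = P\<inverse> D Q\<inverse> D U = P\<inverse> D Q\<inverse>\<close>.\<close>

lemma skew_term_scaled:
  fixes U Q R :: "real^2^2"
  assumes U: "invertible U" "transpose U = U" and Q: "pos_def Q" and R: "pos_def R"
  shows "skew_term R Q (matrix_inv U) z
    = phi2 z (Q + matrix_inv U ** R ** matrix_inv U)
      * Phi2 ((matrix_inv (mat 1 + U ** Q ** U ** matrix_inv R) ** U) *v z)
          (matrix_inv (matrix_inv (U ** Q ** U) + matrix_inv R))"
proof -
  define D where "D = matrix_inv U"
  have D: "invertible D" unfolding D_def by (rule invertible_matrix_inv[OF U(1)])
  have Dt: "transpose D = D"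
    unfolding D_def using matrix_inv_transpose[OF U(1)] U(2) by simp
  have DU: "D ** U = mat 1" unfolding D_def by (rule matrix_inv_mult[OF U(1)])
  define G where "G = U ** Q ** U"
  define P where "P = matrix_inv R + D ** matrix_inv Q ** D"
  have iQ: "invertible Q" by (rule pos_def_invertible[OF Q])
  have iG: "invertible G" unfolding G_def by (intro invertible_mult U iQ)
  have Gi: "matrix_inv G = D ** matrix_inv Q ** D"
    unfolding G_def D_def by (simp add: matrix_inv_matrix_mult U iQ invertible_mult matrix_mul_assoc)
  have iP: "invertible P"
    using pos_def_invertible[OF posterior_precision_pos_def[OF R Q D]] by (simp add: Dt P_def)
  have "mat 1 + G ** matrix_inv R = G ** P"
    by (simp add: P_def Gi[symmetric] matrix_add_ldistrib matrix_inv_mult[OF iG] add.commute)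
  then have "matrix_inv (mat 1 + G ** matrix_inv R) ** U
      = matrix_inv P ** D ** matrix_inv Q ** (D ** U)"
    by (simp add: matrix_inv_matrix_mult iG iP Gi matrix_mul_assoc)
  then have L: "matrix_inv (mat 1 + G ** matrix_inv R) ** U = matrix_inv P ** D ** matrix_inv Q"
    by (simp add: DU)
  have B: "matrix_inv G + matrix_inv R = P" by (simp add: Gi P_def add.commute)
  show ?thesis
    unfolding G_def[symmetric] D_def[symmetric] B L skew_term_def Dt P_def[symmetric]
    by (simp add: matrix_vector_mul_assoc matrix_mul_assoc)
qed

text \<open>The joint normality of the field speaks of a set of index pairs, so a pair density requires
  \<open>(s, i) \<noteq> (s', j)\<close>. This follows from the invertibility assumption: equal indices have correlation one,
  and \<open>\<Omega>(1)\<close> is singular.\<close>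

lemma isotropic_gaussian_field_pair:
  fixes X :: "real^3 \<Rightarrow> 'w \<Rightarrow> real^'m"
  assumes X: "isotropic_gaussian_field M X r"
    and s: "s \<in> unit_sphere" "s' \<in> unit_sphere"
    and inv: "invertible (Omega (r (geodesic_dist s s') $ i $ j))"
  shows "pos_def (Omega (r (geodesic_dist s s') $ i $ j))"
    and "distributed M lborel (\<lambda>\<omega>. vector [X s \<omega> $ i, X s' \<omega> $ j])
      (\<lambda>x. ennreal (phi2 x (Omega (r (geodesic_dist s s') $ i $ j))))"
proof -
  let ?r = "r (geodesic_dist s s') $ i $ j"
  let ?V = "\<lambda>(s, i) \<omega>. X s \<omega> $ i"
  have mean: "(\<integral>\<omega>. X t \<omega> $ k \<partial>M) = 0"
    and "cov M (\<lambda>\<omega>. X t \<omega> $ k) (\<lambda>\<omega>. X t \<omega> $ k) = 1" if "t \<in> unit_sphere" for t k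
    using X that unfolding isotropic_gaussian_field_def by blast+
  then have var: "(\<integral>\<omega>. X t \<omega> $ k * X t \<omega> $ k \<partial>M) = 1" if "t \<in> unit_sphere" for t k
    using that by (simp add: cov_def)
  have "cov M (\<lambda>\<omega>. X s \<omega> $ i) (\<lambda>\<omega>. X s' \<omega> $ j) = ?r"
    using X s unfolding isotropic_gaussian_field_def by blast
  then have cov: "(\<integral>\<omega>. X s \<omega> $ i * X s' \<omega> $ j \<partial>M) = ?r"
    using s mean by (simp add: cov_def)
  have ne: "(s, i) \<noteq> (s', j)"
  proof
    assume "(s, i) = (s', j)"
    then have "?r = 1" unfolding cov[symmetric] using var[OF s(1), of i] by simp
    then show False using inv by (simp add: invertible_det_nz det_2 Omega_def)
  qed
  have V: "jointly_gaussian M {(s, i), (s', j)} ?V"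
  proof -
    have "\<forall>I. finite I \<and> I \<subseteq> unit_sphere \<times> UNIV \<longrightarrow> jointly_gaussian M I ?V"
      using X unfolding isotropic_gaussian_field_def gaussian_random_field_def by (rule conjunct1)
    from this[THEN spec, of "{(s, i), (s', j)}"] show ?thesis using s by simp
  qed
  have S: "Omega ?r = vector
      [vector [\<integral>\<omega>. ?V (s, i) \<omega> * ?V (s, i) \<omega> \<partial>M, \<integral>\<omega>. ?V (s, i) \<omega> * ?V (s', j) \<omega> \<partial>M],
       vector [\<integral>\<omega>. ?V (s, i) \<omega> * ?V (s', j) \<omega> \<partial>M, \<integral>\<omega>. ?V (s', j) \<omega> * ?V (s', j) \<omega> \<partial>M]]"
    by (simp add: Omega_def cov var[OF s(1), of i] var[OF s(2), of j])
  have m: "integral\<^sup>L M (?V (s, i)) = 0" "integral\<^sup>L M (?V (s', j)) = 0"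
    using mean s by simp_all
  show "pos_def (Omega ?r)"
    by (rule jointly_gaussian_pair_distributed(1)[OF V ne m S inv])
  show "distributed M lborel (\<lambda>\<omega>. vector [X s \<omega> $ i, X s' \<omega> $ j]) (\<lambda>x. ennreal (phi2 x (Omega ?r)))"
    using jointly_gaussian_pair_distributed(2)[OF V ne m S inv] by simp
qed

text \<open>\<open>\<Omega>\<^sub>2\<close> is the covariance of a pair with correlation \<open>r\<close> whose components are scaled by \<open>a\<close> and \<open>b\<close>.\<close>

lemma Omega2_eq_congruence:
  "Omega2 a b r = vector [vector [a, 0], vector [0, b]] ** Omega r
     ** transpose (vector [vector [a, 0], vector [0, b]])"
  by (intro matrix_eqI_2)
    (simp_all add: Omega2_def hadamard_def Omega_def matrix_matrix_mult_def transpose_def sum_2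
      power2_eq_square mult_ac)

lemma det_Omega2: "det (Omega2 a b r) = (a * b)\<^sup>2 * det (Omega r)"
  unfolding Omega2_eq_congruence det_mul det_transpose by (simp add: det_2 power2_eq_square mult_ac)

text \<open>Evaluation at two sites is measurable on the path space, so independence of the processes passes to
  the pairs.\<close>

lemma (in prob_space) independent_fields_pair:
  fixes X Y :: "real^3 \<Rightarrow> 'a \<Rightarrow> real^'m"
  assumes "independent_fields M X Y" and s: "s \<in> unit_sphere" "s' \<in> unit_sphere"
  shows "indep_var lborel (\<lambda>\<omega>. vector [X s \<omega> $ i, X s' \<omega> $ j] :: real^2)
    lborel (\<lambda>\<omega>. T *v (vector [Y s \<omega> $ i, Y s' \<omega> $ j] :: real^2) :: real^2)"
proof -
  let ?e = "\<lambda>f :: real^3 \<Rightarrow> real^'m. vector [f s $ i, f s' $ j] :: real^2"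
  have ev: "(\<lambda>f. f t $ k) \<in> borel_measurable (\<Pi>\<^sub>M s\<in>unit_sphere. (borel :: (real^'m) measure))"
    if "t \<in> unit_sphere" for t k
    by (rule measurable_compose[OF measurable_component_singleton[OF that]])
      (intro borel_measurable_continuous_onI continuous_intros)
  have e: "?e \<in> borel_measurable (\<Pi>\<^sub>M s\<in>unit_sphere. borel)"
    by (intro borel_measurable_vector_2 ev s)
  have Te: "(\<lambda>f. T *v ?e f) \<in> borel_measurable (\<Pi>\<^sub>M s\<in>unit_sphere. borel)"
    by (rule measurable_compose[OF e borel_measurable_matrix_vector])
  have "indep_var lborel (?e \<circ> (\<lambda>\<omega>. \<lambda>s\<in>unit_sphere. X s \<omega>))
      lborel ((\<lambda>f. T *v ?e f) \<circ> (\<lambda>\<omega>. \<lambda>s\<in>unit_sphere. Y s \<omega>))"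
    using assms(1) unfolding independent_fields_def
    by (rule indep_var_compose) (simp_all add: e Te)
  then show ?thesis using s by (simp add: comp_def)
qed

theorem proposition3p1:
  fixes M :: "real^'p \<Rightarrow> 'w measure"
    and X Y :: "real^'p \<Rightarrow> real^3 \<Rightarrow> 'w \<Rightarrow> real^'m"
    and rx ry :: "real^'p \<Rightarrow> real \<Rightarrow> real^'m^'m"
    and \<mu> \<eta> \<sigma> :: "real^'p \<Rightarrow> real^'m"
    and lam :: "real^'p"
    and i j :: 'm
    and sk sl :: "real^3"
  assumes "prob_space (M lam)"
    and "isotropic_gaussian_field (M lam) (X lam) (rx lam)"
    and "isotropic_gaussian_field (M lam) (Y lam) (ry lam)"
    and "independent_fields (M lam) (X lam) (Y lam)"
    and "\<forall>a. \<eta> lam $ a \<noteq> 0"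
    and "\<forall>a. \<sigma> lam $ a \<ge> 0"
    and "sk \<in> unit_sphere" and "sl \<in> unit_sphere"
    and "invertible (Omega (rx lam (geodesic_dist sk sl) $ i $ j))"
    and "invertible (Omega2 (\<sigma> lam $ i) (\<sigma> lam $ j) (ry lam (geodesic_dist sk sl) $ i $ j))"
  shows
    "let \<theta> = geodesic_dist sk sl;
         Z = (\<lambda>l. skew_gaussian_field (\<mu> l) (\<eta> l) (\<sigma> l) (X l) (Y l));
         Zpair = (\<lambda>l \<omega>. vector [Z l sk \<omega> $ i, Z l sl \<omega> $ j] :: real^2);
         m = (vector [\<mu> lam $ i, \<mu> lam $ j] :: real^2);
         U = (vector [vector [1 / \<eta> lam $ i, 0], vector [0, 1 / \<eta> lam $ j]] :: real^2^2);
         O2 = Omega2 (\<sigma> lam $ i) (\<sigma> lam $ j) (ry lam \<theta> $ i $ j);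
         R = (\<lambda>t::nat. Omega ((-1) ^ t * rx lam \<theta> $ i $ j));
         A = (\<lambda>t. O2 + matrix_inv U ** R t ** matrix_inv U);
         B = (\<lambda>t. matrix_inv (matrix_inv (U ** O2 ** U) + matrix_inv (R t)));
         L = (\<lambda>t z. (matrix_inv (mat 1 + U ** O2 ** U ** matrix_inv (R t)) ** U) *v (z - m));
         f = (\<lambda>z. 2 * (\<Sum>t=1..2. phi2 (z - m) (A t) * Phi2 (L t z) (B t)))
     in distributed (M lam) lborel (Zpair lam) (\<lambda>z. ennreal (f z)) \<and>
        (\<forall>z. 0 < f z \<and> log_likelihood M Zpair z lam = ln (f z))"
proof -
  interpret prob_space "M lam" by fact
  define r where "r = rx lam (geodesic_dist sk sl) $ i $ j"
  define \<rho> where "\<rho> = ry lam (geodesic_dist sk sl) $ i $ j"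
  define m where "m = (vector [\<mu> lam $ i, \<mu> lam $ j] :: real^2)"
  define D where "D = (vector [vector [\<eta> lam $ i, 0], vector [0, \<eta> lam $ j]] :: real^2^2)"
  define U where "U = (vector [vector [1 / \<eta> lam $ i, 0], vector [0, 1 / \<eta> lam $ j]] :: real^2^2)"
  define T where "T = (vector [vector [\<sigma> lam $ i, 0], vector [0, \<sigma> lam $ j]] :: real^2^2)"
  define Q where "Q = Omega2 (\<sigma> lam $ i) (\<sigma> lam $ j) \<rho>"
  define V where "V = (\<lambda>l \<omega>. vector
    [skew_gaussian_field (\<mu> l) (\<eta> l) (\<sigma> l) (X l) (Y l) sk \<omega> $ i,
     skew_gaussian_field (\<mu> l) (\<eta> l) (\<sigma> l) (X l) (Y l) sl \<omega> $ j] :: real^2)"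
  define f where "f = (\<lambda>z. 2 * (skew_term (Omega (- r)) Q D (z - m) + skew_term (Omega r) Q D (z - m)))"
  have \<eta>: "\<eta> lam $ i \<noteq> 0" "\<eta> lam $ j \<noteq> 0" using assms(5) by auto
  have UD: "U ** D = mat 1"
    using \<eta> by (intro matrix_eqI_2) (simp_all add: U_def D_def matrix_matrix_mult_def sum_2 mat_def)
  then have U: "invertible U" using invertible_right_inverse by blast
  have Ut: "transpose U = U" by (intro matrix_eqI_2) (simp_all add: transpose_def U_def)
  have Ui: "matrix_inv U = D" by (rule matrix_inv_unique[OF UD])
  have D: "invertible D" using invertible_matrix_inv[OF U] by (simp add: Ui)
  have Qd: "det Q \<noteq> 0" using assms(10) unfolding Q_def \<rho>_def by (simp add: invertible_det_nz)
  then have "det (Omega \<rho>) \<noteq> 0" and "\<sigma> lam $ i * \<sigma> lam $ j \<noteq> 0"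
    unfolding Q_def det_Omega2 by auto
  then have Or: "invertible (Omega \<rho>)" and T: "invertible T"
    by (simp_all add: invertible_det_nz T_def det_2)
  note X = isotropic_gaussian_field_pair[OF assms(2,7,8,9), folded r_def]
  note Y = isotropic_gaussian_field_pair[OF assms(3,7,8) Or[unfolded \<rho>_def], folded \<rho>_def]
  have QT: "Q = T ** Omega \<rho> ** transpose T" unfolding Q_def T_def by (rule Omega2_eq_congruence)
  have Q: "pos_def Q" unfolding QT by (rule pos_def_congruence[OF T Y(1)])
  have R: "pos_def (Omega r)" "pos_def (Omega (- r))" using X(1) by (simp_all add: pos_def_Omega)
  have "distributed (M lam) lborel (\<lambda>\<omega>. m + D *v vabs (vector [X lam sk \<omega> $ i, X lam sl \<omega> $ j])
      + T *v vector [Y lam sk \<omega> $ i, Y lam sl \<omega> $ j]) (\<lambda>z. ennreal (f z))"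
    unfolding f_def
    by (rule distributed_skew_gaussian_pair[OF X(2) distributed_phi2_linear[OF Y(2) T Y(1), folded QT]
          independent_fields_pair[OF assms(4,7,8)] X(1) Q D])
  moreover have "V lam = (\<lambda>\<omega>. m + D *v vabs (vector [X lam sk \<omega> $ i, X lam sl \<omega> $ j])
      + T *v vector [Y lam sk \<omega> $ i, Y lam sl \<omega> $ j])"
    by (simp add: fun_eq_iff V_def skew_gaussian_field_def vec_eq_iff forall_2 m_def D_def T_def
        matrix_vector_mult_def sum_2)
  ultimately have dist: "distributed (M lam) lborel (V lam) (\<lambda>z. ennreal (f z))" by simp
  have pos: "0 < f z" for z
    unfolding f_def by (intro mult_pos_pos add_pos_pos skew_term_pos R Q D) simp
  have cont: "continuous_on UNIV (\<lambda>z. skew_term S Q D (z - m))" if "pos_def S" for S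
    by (rule continuous_on_compose2[OF continuous_on_skew_term[OF that Q D]])
      (auto intro!: continuous_intros)
  have "continuous_on UNIV f"
    unfolding f_def by (intro continuous_on_mult continuous_on_add continuous_on_const cont R)
  then have pdf: "continuous_pdf (M lam) (V lam) = f"
    using continuous_pdf_eq dist pos less_imp_le by blast
  have f: "f = (\<lambda>z. 2 * (\<Sum>t=1..2::nat. phi2 (z - m) (Q + matrix_inv U ** Omega ((-1) ^ t * r) ** matrix_inv U)
      * Phi2 ((matrix_inv (mat 1 + U ** Q ** U ** matrix_inv (Omega ((-1) ^ t * r))) ** U) *v (z - m))
          (matrix_inv (matrix_inv (U ** Q ** U) + matrix_inv (Omega ((-1) ^ t * r))))))"
  proof -
    have "{1..2::nat} = {1, 2}" by auto
    then show ?thesis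
      unfolding f_def Ui[symmetric] skew_term_scaled[OF U Ut Q R(1)] skew_term_scaled[OF U Ut Q R(2)]
      by simp
  qed
  have "distributed (M lam) lborel (V lam) (\<lambda>z. ennreal (f z)) \<and>
      (\<forall>z. 0 < f z \<and> log_likelihood M V z lam = ln (f z))"
    using dist pos by (simp add: log_likelihood_def pdf)
  then show ?thesis
    unfolding Let_def f unfolding V_def m_def U_def Q_def r_def \<rho>_def .
qed

end
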